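(* Let $(b,c)$ be a connected weighted graph over $X$ with $\sum_{x\in X}c(x)<\infty$ and $\sum_{x,y\in X,\ b(x,y)>0}\frac1{b(x,y)}<\infty$. Then $(b,c)$ is canonically compactifiable, the completions $\overline X^d$ and $\overline X^\varrho$ are compact, and the unique continuous map $\iota:\overline X^d\to\overline X^\varrho$ extending the identity on $X$ is a homeomorphism. Moreover, $\overline X^\varrho$ and $K$ are homeomorphic via the unique continuous map $\overline X^\varrho\to K$ extending the embedding $x\mapsto\delta_x$ of $X$ into $K$.
   Context: Let $X$ be a countably infinite set. A weighted graph $(b,c)$ over $X$ consists of a symmetric $b:X\times X\to[0,\infty)$ with $b(x,x)=0$ and $\sum_y b(x,y)<\infty$ for all $x$, and $c:X\to[0,\infty)$. A path is a finite sequence $(x_0,\dots,x_n)$ of pairwise distinct vertices with $b(x_{i-1},x_i)>0$; connected means any two distinct vertices are joined by a path. Let $\widetilde Q(f)=\frac12\sum_{x,y}b(x,y)|f(x)-f(y)|^2+\sum_x c(x)|f(x)|^2$ and $\widetilde D=\{f:\widetilde Q(f)<\infty\}$; the graph is canonically compactifiable if $\widetilde D\subseteq\ell^\infty(X)$. Metrics: $d(x,y)=\inf\{\sum_{i=1}^n1/b(x_{i-1},x_i):(x_0,\dots,x_n)\text{ a path from }x\text{ to }y\}$, and $\varrho(x,y)=\sup\{|f(x)-f(y)|:f\in\widetilde D,\ \widetilde Q(f)\le1\}$; $\overline X^d$, $\overline X^\varrho$ denote the metric completions. For a canonically compactifiable graph, let $\mathcal A$ be the sup-norm closure of $\widetilde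 D$ in $\ell^\infty(X)$, $\mathcal A^+$ the smallest $C^*$-subalgebra of $\ell^\infty(X)$ containing $\mathcal A$ and the constant $1$, and $K$ the set of characters (nonzero multiplicative linear functionals) of $\mathcal A^+$ with the weak-$*$ topology; $X$ embeds in $K$ via $x\mapsto\delta_x$, $\delta_x(f)=f(x)$. *)

theory Defs
  imports "HOL-Analysis.Analysis"
begin

text \<open>Weighted graphs over a type 'x (the countably infinite vertex set X = UNIV).\<close>

definition weighted_graph :: "('x \<Rightarrow> 'x \<Rightarrow> real) \<Rightarrow> ('x \<Rightarrow> real) \<Rightarrow> bool" where
  "weighted_graph b c \<longleftrightarrow>
     (\<forall>x y. b x y = b y x) \<and> (\<forall>x y. 0 \<le> b x y) \<and> (\<forall>x. b x x = 0) \<and>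
     (\<forall>x. (\<lambda>y. b x y) summable_on UNIV) \<and> (\<forall>x. 0 \<le> c x)"

definition gpath :: "('x \<Rightarrow> 'x \<Rightarrow> real) \<Rightarrow> 'x list \<Rightarrow> bool" where
  "gpath b xs \<longleftrightarrow> xs \<noteq> [] \<and> distinct xs \<and>
     (\<forall>i. Suc i < length xs \<longrightarrow> b (xs ! i) (xs ! Suc i) > 0)"

definition gconnected :: "('x \<Rightarrow> 'x \<Rightarrow> real) \<Rightarrow> bool" where
  "gconnected b \<longleftrightarrow> (\<forall>x y. x \<noteq> y \<longrightarrow> (\<exists>xs. gpath b xs \<and> hd xs = x \<and> last xs = y))"

definition Qt :: "('x \<Rightarrow> 'x \<Rightarrow> real) \<Rightarrow> ('x \<Rightarrow> real) \<Rightarrow> ('x \<Rightarrow> complex) \<Rightarrow> ennreal" where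
  "Qt b c f = (\<Sum>\<^sub>\<infinity>(x,y)\<in>UNIV. ennreal (b x y * (cmod (f x - f y))\<^sup>2)) / 2
            + (\<Sum>\<^sub>\<infinity>x\<in>UNIV. ennreal (c x * (cmod (f x))\<^sup>2))"

definition Dt :: "('x \<Rightarrow> 'x \<Rightarrow> real) \<Rightarrow> ('x \<Rightarrow> real) \<Rightarrow> ('x \<Rightarrow> complex) set" where
  "Dt b c = {f. Qt b c f < \<infinity>}"

definition linf :: "('x \<Rightarrow> complex) set" where
  "linf = {f. bounded (range f)}"

definition canonically_compactifiable :: "('x \<Rightarrow> 'x \<Rightarrow> real) \<Rightarrow> ('x \<Rightarrow> real) \<Rightarrow> bool" where
  "canonically_compactifiable b c \<longleftrightarrow> Dt b c \<subseteq> linf"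

definition path_length :: "('x \<Rightarrow> 'x \<Rightarrow> real) \<Rightarrow> 'x list \<Rightarrow> real" where
  "path_length b xs = (\<Sum>i<length xs - 1. 1 / b (xs ! i) (xs ! Suc i))"

definition dmet :: "('x \<Rightarrow> 'x \<Rightarrow> real) \<Rightarrow> 'x \<Rightarrow> 'x \<Rightarrow> real" where
  "dmet b x y = Inf {path_length b xs | xs. gpath b xs \<and> hd xs = x \<and> last xs = y}"

definition rhomet :: "('x \<Rightarrow> 'x \<Rightarrow> real) \<Rightarrow> ('x \<Rightarrow> real) \<Rightarrow> 'x \<Rightarrow> 'x \<Rightarrow> real" where
  "rhomet b c x y = Sup {cmod (f x - f y) | f. f \<in> Dt b c \<and> Qt b c f \<le> 1}"

definition is_completion :: "('x \<Rightarrow> 'x \<Rightarrow> real) \<Rightarrow> 'm set \<Rightarrow> ('m \<Rightarrow> 'm \<Rightarrow> real) \<Rightarrow> ('x \<Rightarrow> 'm) \<Rightarrow> bool" where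
  "is_completion \<delta> M dM e \<longleftrightarrow> Metric_space M dM \<and> Metric_space.mcomplete M dM \<and>
     range e \<subseteq> M \<and> (\<forall>x y. dM (e x) (e y) = \<delta> x y) \<and>
     (Metric_space.mtopology M dM) closure_of (range e) = M"

definition supdist :: "('x \<Rightarrow> complex) \<Rightarrow> ('x \<Rightarrow> complex) \<Rightarrow> real" where
  "supdist f g = (SUP x. cmod (f x - g x))"

definition sup_closure :: "('x \<Rightarrow> complex) set \<Rightarrow> ('x \<Rightarrow> complex) set" where
  "sup_closure S = {f \<in> linf. \<forall>\<epsilon>>0. \<exists>g\<in>S \<inter> linf. supdist f g < \<epsilon>}"

definition cstar_subalgebra :: "('x \<Rightarrow> complex) set \<Rightarrow> bool" where
  "cstar_subalgebra S \<longleftrightarrow> S \<subseteq> linf \<and> (\<lambda>_. 0) \<in> S \<and>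
     (\<forall>f\<in>S. \<forall>g\<in>S. (\<lambda>x. f x + g x) \<in> S \<and> (\<lambda>x. f x * g x) \<in> S) \<and>
     (\<forall>a. \<forall>f\<in>S. (\<lambda>x. a * f x) \<in> S) \<and>
     (\<forall>f\<in>S. (\<lambda>x. cnj (f x)) \<in> S) \<and>
     sup_closure S \<subseteq> S"

definition Aalg :: "('x \<Rightarrow> 'x \<Rightarrow> real) \<Rightarrow> ('x \<Rightarrow> real) \<Rightarrow> ('x \<Rightarrow> complex) set" where
  "Aalg b c = sup_closure (Dt b c)"

definition Aplus :: "('x \<Rightarrow> 'x \<Rightarrow> real) \<Rightarrow> ('x \<Rightarrow> real) \<Rightarrow> ('x \<Rightarrow> complex) set" where
  "Aplus b c = \<Inter>{S. cstar_subalgebra S \<and> Aalg b c \<subseteq> S \<and> (\<lambda>_. 1) \<in> S}"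

definition characters :: "('x \<Rightarrow> complex) set \<Rightarrow> (('x \<Rightarrow> complex) \<Rightarrow> complex) set" where
  "characters S = {\<phi> \<in> S \<rightarrow>\<^sub>E UNIV.
      (\<forall>f\<in>S. \<forall>g\<in>S. \<phi> (\<lambda>x. f x + g x) = \<phi> f + \<phi> g \<and> \<phi> (\<lambda>x. f x * g x) = \<phi> f * \<phi> g) \<and>
      (\<forall>a. \<forall>f\<in>S. \<phi> (\<lambda>x. a * f x) = a * \<phi> f) \<and>
      (\<exists>f\<in>S. \<phi> f \<noteq> 0)}"

definition weak_star :: "('x \<Rightarrow> complex) set \<Rightarrow> (('x \<Rightarrow> complex) \<Rightarrow> complex) topology" where
  "weak_star S = subtopology (product_topology (\<lambda>_. euclidean) S) (characters S)"

definition point_eval :: "('x \<Rightarrow> complex) set \<Rightarrow> 'x \<Rightarrow> ('x \<Rightarrow> complex) \<Rightarrow> complex" where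
  "point_eval S x = (\<lambda>f\<in>S. f x)"

end

theory Submission
  imports Defs
begin

text \<open>Cauchy-Schwarz along a path gives \<open>\<rho>\<^sup>2 \<le> 2 d\<close>. Conversely, a function that is 1-Lipschitz for
  \<open>d\<close> satisfies \<open>b(x,y) |f x - f y|\<^sup>2 \<le> 1 / b(x,y)\<close>, so the distance functions \<open>d(\<cdot>,x)\<close> have energy
  bounded uniformly in \<open>x\<close>, whence \<open>d \<le> C \<rho>\<close>. Thus the two metrics are uniformly equivalent, and
  \<open>d\<close> is totally bounded because all but finitely many edges have small total length. Functions
  in \<open>\<A>\<^sup>+\<close> are uniformly continuous and hence extend to the completion, the distance functions
  separate its points, and compactness together with invertibility in \<open>\<A>\<^sup>+\<close> of functions bounded
  away from zero shows that every character is a point evaluation.\<close>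

section \<open>Completions\<close>

text \<open>Completions enter only through \<open>is_completion\<close>, on an arbitrary carrier, so
  their points are accessible only through nearby vertices. Estimates are therefore stated on X,
  with constants uniform over the vertices, and transported by extending uniformly continuous maps
  and by comparing continuous maps on a dense set. Where a triangle inequality is needed, it is that
  of the metric on the completion. The same constraint shapes separation: one threshold must serve
  all base points x, because x is chosen close to a given point of the completion in terms of that
  threshold, and only then is the function d(.,x) known. Beyond uniform equivalence the constants
  carry no meaning. The 2 in \<open>\<rho>\<^sup>2 \<le> 2 d\<close> undoes the 1/2 in front of the
  edge sum, and C is the square root of a uniform energy bound for the distance functions. That
  bound uses summability of 1/b twice: for the edge part of the energy, and to bound d itself,
  without which summability of c would not control the c part.\<close>

lemma completion_extension:
  assumes compl: "is_completion \<delta> M dM e"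
    and N: "Metric_space N dN" "Metric_space.mcomplete N dN"
    and g: "range g \<subseteq> N"
    and uc: "\<And>\<epsilon>. \<epsilon> > 0 \<Longrightarrow> \<exists>\<eta>>0. \<forall>x y. \<delta> x y < \<eta> \<longrightarrow> dN (g x) (g y) < \<epsilon>"
  obtains G where "continuous_map (Metric_space.mtopology M dM) (Metric_space.mtopology N dN) G"
    and "\<And>x. G (e x) = g x"
proof -
  interpret M: Metric_space M dM using compl by (simp add: is_completion_def)
  interpret N: Metric_space N dN by fact
  have e: "range e \<subseteq> M" "\<And>x y. dM (e x) (e y) = \<delta> x y" "M.mtopology closure_of (range e) = M"
    using compl by (auto simp: is_completion_def)
  \<comment> \<open>\<open>e\<close> need not be injective, since \<open>\<delta>\<close> may vanish
    off the diagonal. \<open>g0\<close> is still well defined: \<open>e y = e x\<close> gives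
    \<open>\<delta> y x = 0\<close>, and uniform continuity then leaves no room for
    \<open>g y\<close> and \<open>g x\<close> to differ.\<close>
  define g0 where "g0 p = g (inv e p)" for p
  have g0: "g0 (e x) = g x" for x
  proof (rule ccontr)
    assume ne: "g0 (e x) \<noteq> g x"
    define y where "y = inv e (e x)"
    have "e y = e x"
      unfolding y_def by (simp add: f_inv_into_f)
    then have "\<delta> y x = 0"
      using e(1) M.mdist_zero[of "e x"] e(2)[of y x] by force
    moreover have "dN (g y) (g x) > 0"
      using ne g unfolding g0_def y_def[symmetric] by (intro N.mdist_pos_less) auto
    ultimately show False
      using uc[of "dN (g y) (g x)"] by (metis less_irrefl)
  qed
  have ucm: "uniformly_continuous_map (submetric (metric (M,dM)) (range e)) (metric (N,dN)) g0"
    unfolding uniformly_continuous_map_def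
  proof (intro conjI strip)
    show "g0 \<in> mspace (submetric (metric (M,dM)) (range e)) \<rightarrow> mspace (metric (N,dN))"
      using g g0 e(1) by auto
    fix \<epsilon> :: real assume "\<epsilon> > 0"
    then obtain \<eta> where "\<eta> > 0" and \<eta>: "\<forall>x y. \<delta> x y < \<eta> \<longrightarrow> dN (g x) (g y) < \<epsilon>"
      using uc by blast
    then show "\<exists>\<eta>>0. \<forall>x\<in>mspace (submetric (metric (M,dM)) (range e)).
        \<forall>y\<in>mspace (submetric (metric (M,dM)) (range e)).
          mdist (submetric (metric (M,dM)) (range e)) y x < \<eta> \<longrightarrow> mdist (metric (N,dN)) (g0 y) (g0 x) < \<epsilon>"
      using e g0 by (intro exI[of _ \<eta>]) auto
  qed
  obtain G where G: "uniformly_continuous_map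
       (submetric (metric (M,dM)) (mtopology_of (metric (M,dM)) closure_of (range e))) (metric (N,dN)) G"
     "\<And>p. p \<in> range e \<Longrightarrow> G p = g0 p"
    using uniformly_continuous_map_extends_to_closure_of[OF _ ucm] N(2)
    by (auto simp: mcomplete_of_def)
  have "continuous_map M.mtopology N.mtopology G"
    using uniformly_continuous_imp_continuous_map[OF G(1)] e(3)
    by (simp add: mtopology_of_submetric M.mtopology_of N.mtopology_of)
  then show ?thesis
    using that G(2) g0 by auto
qed

lemma completion_extension_unique:
  assumes compl: "is_completion \<delta> M dM e" and Y: "Hausdorff_space Y"
    and "continuous_map (Metric_space.mtopology M dM) Y f"
    and "continuous_map (Metric_space.mtopology M dM) Y g"
    and "\<And>x. f (e x) = g (e x)" and "p \<in> M"
  shows "f p = g p"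
  using forall_in_closure_of_eq[of p "Metric_space.mtopology M dM" "range e" Y f g] assms
  by (auto simp: is_completion_def)

text \<open>A ball around \<open>p\<close> and the \<open>G\<close>-preimage of a ball around
  \<open>G p\<close> meet in an open set, so one vertex approximates the point and the value at the
  same time. A constant \<open>G\<close> leaves plain density.\<close>

lemma completion_dense:
  assumes compl: "is_completion \<delta> M dM e"
    and G: "continuous_map (Metric_space.mtopology M dM) (euclidean :: 'c::metric_space topology) G"
    and p: "p \<in> M" and s: "s > 0"
  obtains y where "dM p (e y) < s" "dist (G p) (G (e y)) < s"
proof -
  interpret M: Metric_space M dM using compl by (simp add: is_completion_def)
  define U where "U = {q \<in> topspace M.mtopology. G q \<in> ball (G p) s} \<inter> M.mball p s"
  have "openin M.mtopology U"
    unfolding U_def using G by (intro openin_Int openin_continuous_map_preimage[OF G]) auto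
  moreover have "p \<in> U"
    using p s by (auto simp: U_def)
  moreover have "p \<in> M.mtopology closure_of (range e)"
    using compl p by (simp add: is_completion_def)
  ultimately obtain y where "e y \<in> U"
    by (auto simp: in_closure_of)
  then show ?thesis
    by (intro that[of y]) (auto simp: U_def)
qed

lemma completion_compact:
  assumes compl: "is_completion \<delta> M dM e"
    and tb: "\<And>\<epsilon>. \<epsilon> > 0 \<Longrightarrow> \<exists>F. finite F \<and> (\<forall>x. \<exists>y\<in>F. \<delta> x y < \<epsilon>)"
  shows "compact_space (Metric_space.mtopology M dM)"
proof -
  interpret M: Metric_space M dM using compl by (simp add: is_completion_def)
  have e: "range e \<subseteq> M" "\<And>x y. dM (e x) (e y) = \<delta> x y" "M.mtopology closure_of (range e) = M" "M.mcomplete"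
    using compl by (auto simp: is_completion_def)
  have "M.mtotally_bounded (range e)"
    unfolding M.mtotally_bounded_def
  proof (intro strip)
    fix \<epsilon> :: real assume "\<epsilon> > 0"
    then obtain F where F: "finite F" "\<forall>x. \<exists>y\<in>F. \<delta> x y < \<epsilon>"
      using tb by blast
    have "range e \<subseteq> (\<Union>p\<in>e ` F. M.mball p \<epsilon>)"
    proof clarsimp
      fix x
      obtain y where "y \<in> F" "\<delta> x y < \<epsilon>" using F by blast
      then show "\<exists>y\<in>F. e y \<in> M \<and> e x \<in> M \<and> dM (e y) (e x) < \<epsilon>"
        using e(1) e(2)[of x y] M.commute[of "e y" "e x"] by (intro bexI[of _ y]) auto
    qed
    then show "\<exists>K. finite K \<and> K \<subseteq> range e \<and> range e \<subseteq> (\<Union>p\<in>K. M.mball p \<epsilon>)"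
      using F(1) by (intro exI[of _ "e ` F"]) auto
  qed
  then show ?thesis
    using M.mtotally_bounded_closure_of e(3,4) M.compact_space_eq_mcomplete_mtotally_bounded by metis
qed

text \<open>Both identities on X extend, and each composite of the extensions agrees with the
  identity on a dense set, hence everywhere.\<close>

lemma completions_homeomorphic:
  assumes c1: "is_completion \<delta>1 M1 d1 e1" and c2: "is_completion \<delta>2 M2 d2 e2"
    and u12: "\<And>\<epsilon>. \<epsilon> > 0 \<Longrightarrow> \<exists>\<eta>>0. \<forall>x y. \<delta>1 x y < \<eta> \<longrightarrow> \<delta>2 x y < \<epsilon>"
    and u21: "\<And>\<epsilon>. \<epsilon> > 0 \<Longrightarrow> \<exists>\<eta>>0. \<forall>x y. \<delta>2 x y < \<eta> \<longrightarrow> \<delta>1 x y < \<epsilon>"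
  obtains \<iota> where "continuous_map (Metric_space.mtopology M1 d1) (Metric_space.mtopology M2 d2) \<iota>"
    "\<forall>x. \<iota> (e1 x) = e2 x"
    "homeomorphic_map (Metric_space.mtopology M1 d1) (Metric_space.mtopology M2 d2) \<iota>"
proof -
  interpret M1: Metric_space M1 d1 using c1 by (simp add: is_completion_def)
  interpret M2: Metric_space M2 d2 using c2 by (simp add: is_completion_def)
  obtain i where i: "continuous_map M1.mtopology M2.mtopology i" "\<And>x. i (e1 x) = e2 x"
    using c2 u12 by (auto simp: is_completion_def intro: completion_extension[OF c1, of M2 d2 e2])
  obtain j where j: "continuous_map M2.mtopology M1.mtopology j" "\<And>x. j (e2 x) = e1 x"
    using c1 u21 by (auto simp: is_completion_def intro: completion_extension[OF c2, of M1 d1 e1])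
  have "(j \<circ> i) p = id p" if "p \<in> M1" for p
    by (rule completion_extension_unique[where f = "j \<circ> i" and g = id, OF c1 M1.Hausdorff_space_mtopology])
       (use i j that continuous_map_compose[OF i(1) j(1)] in auto)
  moreover have "(i \<circ> j) q = id q" if "q \<in> M2" for q
    by (rule completion_extension_unique[where f = "i \<circ> j" and g = id, OF c2 M2.Hausdorff_space_mtopology])
       (use i j that continuous_map_compose[OF j(1) i(1)] in auto)
  ultimately have "homeomorphic_maps M1.mtopology M2.mtopology i j"
    using i j by (simp add: homeomorphic_maps_def)
  then show ?thesis
    using that i homeomorphic_maps_map by blast
qed

section \<open>Characters of unital C*-subalgebras of bounded functions\<close>

text \<open>\<open>supdist\<close> is a real \<open>SUP\<close>, so it bounds the pointwise
  differences only once these are known to be bounded.\<close>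

lemma cmod_diff_le_supdist:
  assumes "f \<in> linf" "g \<in> linf"
  shows "cmod (f x - g x) \<le> supdist f g"
proof -
  obtain B C where "\<And>x. cmod (f x) \<le> B" "\<And>x. cmod (g x) \<le> C"
    using assms by (auto simp: linf_def bounded_iff)
  then have "bdd_above (range (\<lambda>x. cmod (f x - g x)))"
    by (intro bdd_aboveI2[of _ _ "B + C"]) (meson add_mono norm_triangle_ineq4 order_trans)
  then show ?thesis
    unfolding supdist_def by (intro cSUP_upper) auto
qed

lemma supdist_le:
  assumes "\<And>x. cmod (f x - g x) \<le> r"
  shows "supdist f g \<le> r"
  unfolding supdist_def using assms by (intro cSUP_least) auto

lemma sup_closure_mono: "S \<subseteq> T \<Longrightarrow> sup_closure S \<subseteq> sup_closure T"
  unfolding sup_closure_def by blast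

lemma sup_closure_superset: "S \<inter> linf \<subseteq> sup_closure S"
  unfolding sup_closure_def
  by (smt (verit) IntE mem_Collect_eq subsetI supdist_le norm_zero right_minus_eq)

lemma sup_closureD:
  assumes "f \<in> sup_closure S" "\<epsilon> > 0"
  obtains g where "g \<in> S" "g \<in> linf" "supdist f g < \<epsilon>"
  using assms unfolding sup_closure_def by blast

text \<open>\<open>S\<close> shows that the intersection defining \<open>Aplus\<close> runs over a
  nonempty family; an empty one would yield all functions, unbounded ones included. Closedness
  passes to the intersection by monotonicity of \<open>sup_closure\<close>.\<close>

lemma cstar_subalgebra_Aplus:
  assumes "Aalg b c \<subseteq> S" "cstar_subalgebra S" "(\<lambda>_. 1) \<in> S"
  shows "cstar_subalgebra (Aplus b c)"
proof -
  have "Aplus b c \<subseteq> S"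
    unfolding Aplus_def using assms by blast
  moreover have "sup_closure (Aplus b c) \<subseteq> T"
    if "cstar_subalgebra T \<and> Aalg b c \<subseteq> T \<and> (\<lambda>_. 1) \<in> T" for T
  proof -
    have "Aplus b c \<subseteq> T"
      using that unfolding Aplus_def by blast
    then show ?thesis
      using sup_closure_mono[of "Aplus b c" T] that by (auto simp: cstar_subalgebra_def)
  qed
  then have "sup_closure (Aplus b c) \<subseteq> Aplus b c"
    unfolding Aplus_def[of b c] by (intro Inter_greatest) auto
  ultimately show ?thesis
    using assms(2) unfolding cstar_subalgebra_def[of "Aplus b c"]
    by (auto simp: Aplus_def cstar_subalgebra_def)
qed

text \<open>Each of these functions extends continuously to every completion for
  \<open>\<delta>\<close>. Boundedness is built in because a competitor in the intersection defining
  \<open>Aplus\<close> has to lie in \<open>linf\<close>; taken for \<rho>, this algebra is the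
  upper bound for \<open>Aplus\<close>.\<close>

definition uniformly_continuous_functions :: "('x \<Rightarrow> 'x \<Rightarrow> real) \<Rightarrow> ('x \<Rightarrow> complex) set" where
  "uniformly_continuous_functions \<delta> =
     {f \<in> linf. \<forall>\<epsilon>>0. \<exists>\<eta>>0. \<forall>x y. \<delta> x y < \<eta> \<longrightarrow> cmod (f x - f y) < \<epsilon>}"

lemma uniformly_continuous_functionsD:
  assumes "f \<in> uniformly_continuous_functions \<delta>" "\<epsilon> > 0"
  obtains \<eta> where "\<eta> > 0" "\<And>x y. \<delta> x y < \<eta> \<Longrightarrow> cmod (f x - f y) < \<epsilon>"
  using assms unfolding uniformly_continuous_functions_def by blast

lemma cstar_subalgebra_uniformly_continuous_functions:
  "cstar_subalgebra (uniformly_continuous_functions \<delta>)"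
proof -
  let ?U = "uniformly_continuous_functions \<delta>"
  have add: "(\<lambda>x. f x + g x) \<in> ?U" if f: "f \<in> ?U" and g: "g \<in> ?U" for f g
  proof -
    have "(\<lambda>x. f x + g x) \<in> linf"
      using f g bounded_plus_comp[of f UNIV g]
      by (simp add: uniformly_continuous_functions_def linf_def)
    moreover have "\<exists>\<eta>>0. \<forall>x y. \<delta> x y < \<eta> \<longrightarrow> cmod (f x + g x - (f y + g y)) < \<epsilon>" if "\<epsilon> > 0" for \<epsilon>
    proof -
      obtain \<eta>1 where 1: "\<eta>1 > 0" "\<And>x y. \<delta> x y < \<eta>1 \<Longrightarrow> cmod (f x - f y) < \<epsilon> / 2"
        using uniformly_continuous_functionsD[OF f, of "\<epsilon> / 2"] \<open>\<epsilon> > 0\<close> by auto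
      obtain \<eta>2 where 2: "\<eta>2 > 0" "\<And>x y. \<delta> x y < \<eta>2 \<Longrightarrow> cmod (g x - g y) < \<epsilon> / 2"
        using uniformly_continuous_functionsD[OF g, of "\<epsilon> / 2"] \<open>\<epsilon> > 0\<close> by auto
      have "cmod (f x + g x - (f y + g y)) < \<epsilon>" if "\<delta> x y < min \<eta>1 \<eta>2" for x y
        using 1(2)[of x y] 2(2)[of x y] that norm_diff_triangle_ineq[of "f x" "g x" "f y" "g y"] by simp
      then show ?thesis
        using 1(1) 2(1) by (intro exI[of _ "min \<eta>1 \<eta>2"]) auto
    qed
    ultimately show ?thesis
      by (simp add: uniformly_continuous_functions_def)
  qed
  have mult: "(\<lambda>x. f x * g x) \<in> ?U" if f: "f \<in> ?U" and g: "g \<in> ?U" for f g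
  proof -
    obtain B where B: "B > 0" "\<And>x. cmod (f x) \<le> B" "\<And>x. cmod (g x) \<le> B"
    proof -
      obtain B1 B2 where "\<And>x. cmod (f x) \<le> B1" "\<And>x. cmod (g x) \<le> B2"
        using f g by (auto simp: uniformly_continuous_functions_def linf_def bounded_iff)
      then show ?thesis
        by (intro that[of "max 1 (max B1 B2)"]) (auto simp: le_max_iff_disj)
    qed
    have "cmod (f x * g x) \<le> B * B" for x
      using B by (simp add: norm_mult mult_mono)
    then have "(\<lambda>x. f x * g x) \<in> linf"
      by (auto simp: linf_def bounded_iff)
    moreover have "\<exists>\<eta>>0. \<forall>x y. \<delta> x y < \<eta> \<longrightarrow> cmod (f x * g x - f y * g y) < \<epsilon>" if "\<epsilon> > 0" for \<epsilon>
    proof -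
      have *: "\<epsilon> / (2 * B) > 0"
        using \<open>\<epsilon> > 0\<close> B by simp
      obtain \<eta>1 where 1: "\<eta>1 > 0" "\<And>x y. \<delta> x y < \<eta>1 \<Longrightarrow> cmod (f x - f y) < \<epsilon> / (2 * B)"
        using uniformly_continuous_functionsD[OF f *] by blast
      obtain \<eta>2 where 2: "\<eta>2 > 0" "\<And>x y. \<delta> x y < \<eta>2 \<Longrightarrow> cmod (g x - g y) < \<epsilon> / (2 * B)"
        using uniformly_continuous_functionsD[OF g *] by blast
      have "cmod (f x * g x - f y * g y) < \<epsilon>" if "\<delta> x y < min \<eta>1 \<eta>2" for x y
      proof -
        have "f x * g x - f y * g y = f x * (g x - g y) + (f x - f y) * g y"
          by (simp add: algebra_simps)
        then have "cmod (f x * g x - f y * g y) \<le> cmod (f x) * cmod (g x - g y) + cmod (f x - f y) * cmod (g y)"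
          by (metis norm_mult norm_triangle_ineq)
        also have "\<dots> \<le> B * cmod (g x - g y) + cmod (f x - f y) * B"
          using B by (intro add_mono mult_mono) auto
        also have "\<dots> < B * (\<epsilon> / (2 * B)) + \<epsilon> / (2 * B) * B"
          using B(1) 1(2)[of x y] 2(2)[of x y] that
          by (intro add_strict_mono mult_strict_left_mono mult_strict_right_mono) auto
        also have "\<dots> = \<epsilon>"
          using B(1) by simp
        finally show ?thesis .
      qed
      then show ?thesis
        using 1(1) 2(1) by (intro exI[of _ "min \<eta>1 \<eta>2"]) auto
    qed
    ultimately show ?thesis
      by (simp add: uniformly_continuous_functions_def)
  qed
  have const: "(\<lambda>x. a) \<in> ?U" for a
    by (auto simp: uniformly_continuous_functions_def linf_def intro: exI[of _ 1])
  have cnj: "(\<lambda>x. cnj (f x)) \<in> ?U" if "f \<in> ?U" for f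
    using that by (simp add: uniformly_continuous_functions_def linf_def bounded_iff flip: complex_cnj_diff)
  have closed: "f \<in> ?U" if f: "f \<in> sup_closure ?U" for f
  proof -
    have "\<exists>\<eta>>0. \<forall>x y. \<delta> x y < \<eta> \<longrightarrow> cmod (f x - f y) < \<epsilon>" if "\<epsilon> > 0" for \<epsilon>
    proof -
      have "\<epsilon> / 3 > 0"
        using that by simp
      then obtain g where g: "g \<in> ?U" "g \<in> linf" "supdist f g < \<epsilon> / 3"
        by (rule sup_closureD[OF f])
      have fg: "cmod (f x - g x) < \<epsilon> / 3" for x
        using cmod_diff_le_supdist[of f g x] g f by (simp add: sup_closure_def)
      obtain \<eta> where \<eta>: "\<eta> > 0" "\<And>x y. \<delta> x y < \<eta> \<Longrightarrow> cmod (g x - g y) < \<epsilon> / 3"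
        using uniformly_continuous_functionsD[OF g(1), of "\<epsilon> / 3"] \<open>\<epsilon> > 0\<close> by auto
      have "cmod (f x - f y) < \<epsilon>" if "\<delta> x y < \<eta>" for x y
      proof -
        have "f x - f y = (f x - g x) + (g x - g y) - (f y - g y)"
          by simp
        then have "cmod (f x - f y) \<le> cmod (f x - g x) + cmod (g x - g y) + cmod (f y - g y)"
          by (metis norm_triangle_ineq norm_triangle_ineq4 add_right_mono order_trans)
        then show ?thesis
          using fg[of x] fg[of y] \<eta>(2)[OF that] by simp
      qed
      then show ?thesis using \<eta>(1) by blast
    qed
    then show ?thesis
      using f by (simp add: uniformly_continuous_functions_def sup_closure_def)
  qed
  show ?thesis
    unfolding cstar_subalgebra_def
  proof (intro conjI ballI allI)
    show "?U \<subseteq> linf"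
      by (auto simp: uniformly_continuous_functions_def)
  qed (use closed in \<open>auto intro: add mult const cnj\<close>)
qed

section \<open>Inverses and approximation of characters by points in a unital C*-subalgebra\<close>

locale unital_cstar_subalgebra =
  fixes S :: "('x \<Rightarrow> complex) set"
  assumes cstar: "cstar_subalgebra S" and one: "(\<lambda>_. 1) \<in> S"
begin

lemma linf: "f \<in> S \<Longrightarrow> f \<in> linf"
  and zero: "(\<lambda>_. 0) \<in> S"
  and add: "f \<in> S \<Longrightarrow> g \<in> S \<Longrightarrow> (\<lambda>x. f x + g x) \<in> S"
  and mult: "f \<in> S \<Longrightarrow> g \<in> S \<Longrightarrow> (\<lambda>x. f x * g x) \<in> S"
  and scale: "f \<in> S \<Longrightarrow> (\<lambda>x. a * f x) \<in> S"
  and cnj: "f \<in> S \<Longrightarrow> (\<lambda>x. cnj (f x)) \<in> S"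
  and closed: "f \<in> sup_closure S \<Longrightarrow> f \<in> S"
  using cstar unfolding cstar_subalgebra_def by blast+

lemma const: "(\<lambda>_. a) \<in> S"
  using scale[OF one, of a] by simp

lemma diff_const: "f \<in> S \<Longrightarrow> (\<lambda>x. f x - a) \<in> S"
  using add[OF _ const[of "- a"], of f] by simp

lemma power: "f \<in> S \<Longrightarrow> (\<lambda>x. f x ^ n) \<in> S"
  by (induction n) (auto simp: one mult)

lemma sum: "(\<And>i. i \<in> I \<Longrightarrow> f i \<in> S) \<Longrightarrow> (\<lambda>x. \<Sum>i\<in>I. f i x) \<in> S"
  by (induction I rule: infinite_finite_induct) (auto simp: zero add)

text \<open>Neumann series: if R bounds h from above, then u = 1 - h/R takes values in [0,\<theta>]
  with \<theta> < 1, and R/h = 1/(1 - u) is the uniform limit of the partial sums of the powers of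
  u. These lie in \<open>S\<close>, which is closed.\<close>

lemma inverse:
  fixes h :: "'x \<Rightarrow> real"
  assumes h: "(\<lambda>x. complex_of_real (h x)) \<in> S" and \<delta>: "\<delta> > 0" "\<And>x. \<delta> \<le> h x"
  shows "(\<lambda>x. complex_of_real (1 / h x)) \<in> S"
proof -
  obtain R where R: "\<And>x. h x \<le> R"
  proof -
    obtain R where "\<And>x. cmod (complex_of_real (h x)) \<le> R"
      using linf[OF h] by (auto simp: linf_def bounded_iff)
    then show ?thesis
      by (intro that[of R]) (metis abs_ge_self norm_of_real order_trans)
  qed
  have "R > 0"
    using \<delta> R by (meson less_le_trans)
  define u where "u x = 1 - h x / R" for x
  define \<theta> where "\<theta> = 1 - \<delta> / R"
  have u: "0 \<le> u x" "u x \<le> \<theta>" for x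
    using \<delta>(2)[of x] R[of x] \<open>R > 0\<close> by (auto simp: u_def \<theta>_def field_simps)
  \<comment> \<open>That \<theta> is nonnegative is read off from
    \<open>0 \<le> u x \<le> \<theta>\<close> at some point; \<open>undefined\<close> serves as an
    arbitrary one.\<close>
  have \<theta>: "0 \<le> \<theta>" "\<theta> < 1"
    using order_trans[OF u(1) u(2)[of undefined]] \<delta>(1) \<open>R > 0\<close> by (auto simp: \<theta>_def)
  have uS: "(\<lambda>x. complex_of_real (u x)) \<in> S"
    using add[OF scale[OF h, of "of_real (- 1 / R)"] one] \<open>R > 0\<close> by (simp add: u_def)
  define p where "p n x = (\<Sum>i<n. complex_of_real (u x) ^ i)" for n x
  have pS: "p n \<in> S" for n
    unfolding p_def[abs_def] by (intro sum power uS)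
  have quotient: "R / h x = 1 / (1 - u x)" for x
    using \<open>R > 0\<close> by (simp add: u_def)
  have err: "cmod (complex_of_real (R / h x) - p n x) \<le> \<theta> ^ n / (1 - \<theta>)" for n x
  proof -
    have "u x \<noteq> 1"
      using u[of x] \<theta> by simp
    then have "(\<Sum>i<n. u x ^ i) = (1 - u x ^ n) / (1 - u x)"
      by (simp add: sum_gp_strict)
    then have "R / h x - (\<Sum>i<n. u x ^ i) = u x ^ n / (1 - u x)"
      unfolding quotient by (simp add: diff_divide_distrib)
    moreover have "complex_of_real (R / h x) - p n x = complex_of_real (R / h x - (\<Sum>i<n. u x ^ i))"
      by (simp add: p_def)
    ultimately have "cmod (complex_of_real (R / h x) - p n x) = u x ^ n / (1 - u x)"
      using u[of x] \<theta> by (simp only: norm_of_real) simp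
    also have "\<dots> \<le> \<theta> ^ n / (1 - \<theta>)"
      using u[of x] \<theta> by (intro frac_le power_mono) auto
    finally show ?thesis .
  qed
  have "(\<lambda>x. complex_of_real (R / h x)) \<in> sup_closure S"
    unfolding sup_closure_def
  proof (intro CollectI conjI strip)
    have "R / h x \<le> R / \<delta>" "0 \<le> R / h x" for x
      using \<delta>(1) \<delta>(2)[of x] \<open>R > 0\<close> by (auto intro: divide_left_mono)
    then show "(\<lambda>x. complex_of_real (R / h x)) \<in> linf"
      unfolding linf_def bounded_iff
      by (auto intro!: exI[of _ "R / \<delta>"] simp del: of_real_divide norm_divide abs_divide)
    fix \<epsilon> :: real assume "\<epsilon> > 0"
    have "(\<lambda>n. \<theta> ^ n / (1 - \<theta>)) \<longlonglongrightarrow> 0 / (1 - \<theta>)"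
      using \<theta> by (intro tendsto_intros LIMSEQ_realpow_zero) auto
    then have "\<forall>\<^sub>F n in sequentially. \<theta> ^ n / (1 - \<theta>) < \<epsilon>"
      using \<open>\<epsilon> > 0\<close> by (intro order_tendstoD) auto
    then obtain n where "\<theta> ^ n / (1 - \<theta>) < \<epsilon>"
      by (auto simp: eventually_sequentially)
    then have "supdist (\<lambda>x. complex_of_real (R / h x)) (p n) < \<epsilon>"
      using supdist_le[of "\<lambda>x. complex_of_real (R / h x)" "p n", OF err[of _ n]] by linarith
    then show "\<exists>g\<in>S \<inter> linf. supdist (\<lambda>x. complex_of_real (R / h x)) g < \<epsilon>"
      using pS linf by blast
  qed
  then have "(\<lambda>x. complex_of_real (1 / R) * complex_of_real (R / h x)) \<in> S"
    by (rule scale[OF closed])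
  moreover have "(\<lambda>x. complex_of_real (1 / R) * complex_of_real (R / h x)) = (\<lambda>x. complex_of_real (1 / h x))"
    using \<open>R > 0\<close> by auto
  ultimately show ?thesis
    by (simp only:)
qed

text \<open>If no point approximates the character on the given functions, then the sum of the
  \<open>|f - \<phi> f|\<^sup>2\<close> is an invertible element of the kernel.\<close>

lemma character_approx:
  assumes \<phi>: "\<phi> \<in> characters S" and F: "finite F" "F \<subseteq> S" and "\<epsilon> > 0"
  obtains x where "\<And>f. f \<in> F \<Longrightarrow> cmod (f x - \<phi> f) < \<epsilon>"
proof (rule ccontr)
  assume "\<not> thesis"
  then have far: "\<exists>f\<in>F. \<epsilon> \<le> cmod (f x - \<phi> f)" for x
    using that by (meson not_le)
  have \<phi>_add: "\<phi> (\<lambda>x. f x + g x) = \<phi> f + \<phi> g" and \<phi>_mult: "\<phi> (\<lambda>x. f x * g x) = \<phi> f * \<phi> g"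
    if "f \<in> S" "g \<in> S" for f g
    using \<phi> that by (auto simp: characters_def)
  have \<phi>_scale: "\<phi> (\<lambda>x. a * f x) = a * \<phi> f" if "f \<in> S" for a f
    using \<phi> that by (auto simp: characters_def)
  \<comment> \<open>A nonzero value forces \<open>\<phi>\<close> to be unital:
    \<open>\<phi> f0 = \<phi> 1 * \<phi> f0\<close>.\<close>
  obtain f0 where "f0 \<in> S" "\<phi> f0 \<noteq> 0"
    using \<phi> by (auto simp: characters_def)
  then have \<phi>1: "\<phi> (\<lambda>_. 1) = 1"
    using \<phi>_mult[OF one, of f0] by simp
  \<comment> \<open>This is \<open>|f - \<phi> f|\<^sup>2\<close> written as a product inside the
    algebra. The definition of characters says nothing about conjugates, but \<open>\<phi>\<close>
    annihilates the first factor, and by multiplicativity the product.\<close>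
  define t where "t f x = (f x - \<phi> f) * cnj (f x - \<phi> f)" for f x
  have t: "t f \<in> S" "\<phi> (t f) = 0" if "f \<in> S" for f
  proof -
    have fS: "(\<lambda>x. f x - \<phi> f) \<in> S"
      using that by (rule diff_const)
    show "t f \<in> S"
      unfolding t_def[abs_def] by (intro mult cnj fS)
    have "\<phi> (\<lambda>x. f x + - \<phi> f * 1) = 0"
      using \<phi>_add[OF that const[of "- \<phi> f"]] \<phi>_scale[OF one, of "- \<phi> f"] \<phi>1 by simp
    then have "\<phi> (\<lambda>x. f x - \<phi> f) = 0"
      by simp
    then show "\<phi> (t f) = 0"
      unfolding t_def[abs_def] using \<phi>_mult[OF fS cnj[OF fS]] by simp
  qed
  have \<phi>0: "\<phi> (\<lambda>_. 0) = 0"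
    using \<phi>_scale[OF one, of 0] by simp
  have "\<phi> (\<lambda>x. \<Sum>f\<in>G. t f x) = 0" if "finite G" "G \<subseteq> S" for G
    using that
  proof (induction G rule: finite_induct)
    case (insert f G)
    then show ?case
      using \<phi>_add[OF t(1)[of f] sum[of G t]] t by (auto simp: subset_iff)
  qed (simp add: \<phi>0)
  then have ker: "\<phi> (\<lambda>x. \<Sum>f\<in>F. t f x) = 0"
    using F by blast
  define h where "h x = (\<Sum>f\<in>F. (cmod (f x - \<phi> f))\<^sup>2)" for x
  have h_eq: "(\<lambda>x. complex_of_real (h x)) = (\<lambda>x. \<Sum>f\<in>F. t f x)"
    unfolding h_def t_def by (simp only: of_real_sum complex_norm_square)
  have hS: "(\<lambda>x. complex_of_real (h x)) \<in> S"
    unfolding h_eq using t F by (intro sum) auto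
  have h_ge: "\<epsilon>\<^sup>2 \<le> h x" for x
  proof -
    obtain f where f: "f \<in> F" "\<epsilon> \<le> cmod (f x - \<phi> f)"
      using far by blast
    then have "\<epsilon>\<^sup>2 \<le> (cmod (f x - \<phi> f))\<^sup>2"
      using \<open>\<epsilon> > 0\<close> by (intro power_mono) auto
    also have "\<dots> \<le> h x"
      unfolding h_def using F f by (intro member_le_sum) auto
    finally show ?thesis .
  qed
  have "h x \<noteq> 0" for x
    using h_ge[of x] \<open>\<epsilon> > 0\<close> by (metis not_le zero_less_power)
  then have "(\<lambda>x. complex_of_real (h x) * complex_of_real (1 / h x)) = (\<lambda>_. 1)"
    by auto
  then show False
    using \<phi>_mult[OF hS inverse[OF hS _ h_ge]] \<open>\<epsilon> > 0\<close> ker \<phi>1 by (simp add: h_eq)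
qed

end

section \<open>The completion as the space of characters\<close>

lemma Hausdorff_space_weak_star: "Hausdorff_space (weak_star S)"
  unfolding weak_star_def
  by (intro Hausdorff_space_subtopology) (simp add: Hausdorff_space_product_topology)
lemma continuous_map_complex_mult:
  fixes f g :: "'a \<Rightarrow> complex"
  assumes "continuous_map X euclidean f" "continuous_map X euclidean g"
  shows "continuous_map X euclidean (\<lambda>x. f x * g x)"
  using assms by (simp add: continuous_map_atin tendsto_mult)

text \<open>Compactness of the completion turns the finitary approximation of a character by points
  into equality with evaluation at one point of the completion.\<close>

lemma completion_homeomorphic_characters:
  assumes compl: "is_completion \<delta> M dM e"
    and compact: "compact_space (Metric_space.mtopology M dM)"
    and S: "cstar_subalgebra S" "(\<lambda>_. 1) \<in> S" "S \<subseteq> uniformly_continuous_functions \<delta>"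
    and sep: "\<And>r. r > 0 \<Longrightarrow> \<exists>s>0. \<forall>x. \<exists>f\<in>S. \<forall>y z. \<delta> y x < s \<and> r \<le> \<delta> z x \<longrightarrow> s \<le> cmod (f y - f z)"
  obtains \<kappa> where "continuous_map (Metric_space.mtopology M dM) (weak_star S) \<kappa>"
    "\<forall>x. \<kappa> (e x) = point_eval S x"
    "homeomorphic_map (Metric_space.mtopology M dM) (weak_star S) \<kappa>"
proof -
  interpret M: Metric_space M dM using compl by (simp add: is_completion_def)
  interpret S: unital_cstar_subalgebra S using S by unfold_locales
  have e: "e x \<in> M" "dM (e x) (e y) = \<delta> x y" for x y
    using compl by (auto simp: is_completion_def)
  have "\<exists>G. continuous_map M.mtopology euclidean G \<and> (\<forall>x. G (e x) = f x)" if "f \<in> S" for f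
  proof -
    have f: "f \<in> uniformly_continuous_functions \<delta>"
      using that S(3) by blast
    have uc: "\<exists>\<eta>>0. \<forall>x y. \<delta> x y < \<eta> \<longrightarrow> dist (f x) (f y) < \<epsilon>" if "\<epsilon> > 0" for \<epsilon>
      using uniformly_continuous_functionsD[OF f that] by (metis dist_norm)
    show ?thesis
      by (rule completion_extension[OF compl, of UNIV dist f])
         (use uc in \<open>auto simp: complete_UNIV Met_TC.Metric_space_axioms\<close>)
  qed
  then obtain G where G_cont: "\<And>f. f \<in> S \<Longrightarrow> continuous_map M.mtopology euclidean (G f)"
    and G: "\<And>f x. f \<in> S \<Longrightarrow> G f (e x) = f x"
    by metis
  \<comment> \<open>The extensions inherit every algebraic identity: both sides are continuous and
    agree on the dense image of \<open>e\<close>.\<close>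
  note unique = completion_extension_unique[OF compl Hausdorff_space_euclidean]
  have G_add: "G (\<lambda>x. f x + g x) p = G f p + G g p" and G_mult: "G (\<lambda>x. f x * g x) p = G f p * G g p"
    if "f \<in> S" "g \<in> S" "p \<in> M" for f g p
  proof -
    show "G (\<lambda>x. f x + g x) p = G f p + G g p"
      by (rule unique[where g = "\<lambda>p. G f p + G g p", OF G_cont[OF S.add]])
         (use that S.add in \<open>simp_all add: G G_cont continuous_map_add\<close>)
    show "G (\<lambda>x. f x * g x) p = G f p * G g p"
      by (rule unique[where g = "\<lambda>p. G f p * G g p", OF G_cont[OF S.mult]])
         (use that S.mult in \<open>simp_all add: G G_cont continuous_map_complex_mult\<close>)
  qed
  have G_scale: "G (\<lambda>x. a * f x) p = a * G f p" if "f \<in> S" "p \<in> M" for a f p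
    by (rule unique[where g = "\<lambda>p. a * G f p", OF G_cont[OF S.scale]])
       (use that S.scale in \<open>simp_all add: G G_cont continuous_map_complex_mult\<close>)
  have G_one: "G (\<lambda>_. 1) p = 1" if "p \<in> M" for p
    by (rule unique[where g = "\<lambda>_. 1", OF G_cont[OF S.one]]) (use that G S.one in simp_all)
  define \<kappa> where "\<kappa> p = (\<lambda>f\<in>S. G f p)" for p
  have \<kappa>_char: "\<kappa> p \<in> characters S" if "p \<in> M" for p
  proof -
    have "\<exists>f\<in>S. G f p \<noteq> 0"
      using G_one[OF that] S.one by (metis zero_neq_one)
    then show ?thesis
      using that unfolding characters_def \<kappa>_def
      by (auto simp add: G_add G_mult G_scale S.add S.mult S.scale)
  qed
  have \<kappa>_cont: "continuous_map M.mtopology (weak_star S) \<kappa>"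
    unfolding weak_star_def continuous_map_in_subtopology continuous_map_componentwise
  proof (intro conjI ballI)
    fix f assume "f \<in> S"
    then show "continuous_map M.mtopology euclidean (\<lambda>p. \<kappa> p f)"
      using G_cont by (simp add: \<kappa>_def)
  qed (use \<kappa>_char in \<open>auto simp: \<kappa>_def\<close>)
  have \<kappa>_e: "\<kappa> (e x) = point_eval S x" for x
    unfolding \<kappa>_def point_eval_def by (auto simp: G)
  have "characters S \<subseteq> extensional S"
    by (auto simp: characters_def PiE_def)
  then have topspace: "topspace (weak_star S) = characters S"
    unfolding weak_star_def by (auto simp: PiE_def)
  have inj: "inj_on \<kappa> M"
  proof (rule inj_onI, rule ccontr)
    fix p q assume p: "p \<in> M" and q: "q \<in> M" and eq: "\<kappa> p = \<kappa> q" and "p \<noteq> q"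
    \<comment> \<open>The order of choices is r, s, x, f, and only then y and z, so p is
      approximated twice: x determines f, and y must also have a value of f close to
      \<open>G f p\<close>. As \<open>dM p q = 2 * r\<close> while x and z lie within r/2 of p and
      q, at least r remains between z and x; y and x are less than s/2 + s/2 apart. Equality of
      \<open>G f p\<close> and \<open>G f q\<close> then puts the values of f at y and z less than s
      apart.\<close>
    define r where "r = dM p q / 2"
    have "r > 0"
      using p q \<open>p \<noteq> q\<close> by (simp add: r_def)
    then obtain s where "s > 0"
      and s: "\<forall>x. \<exists>f\<in>S. \<forall>y z. \<delta> y x < s \<and> r \<le> \<delta> z x \<longrightarrow> s \<le> cmod (f y - f z)"
      using sep by blast
    obtain x where x: "dM p (e x) < min (s / 2) (r / 2)"
      using completion_dense[OF compl continuous_map_const[THEN iffD2], of 0 p "min (s / 2) (r / 2)"]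
        p \<open>s > 0\<close> \<open>r > 0\<close> by auto
    obtain f where "f \<in> S" and f: "\<And>y z. \<delta> y x < s \<Longrightarrow> r \<le> \<delta> z x \<Longrightarrow> s \<le> cmod (f y - f z)"
      using s by blast
    obtain y where y: "dM p (e y) < s / 2" "dist (G f p) (G f (e y)) < s / 2"
      using completion_dense[OF compl G_cont[OF \<open>f \<in> S\<close>] p, of "s / 2"] \<open>s > 0\<close> by auto
    obtain z where z: "dM q (e z) < min (s / 2) (r / 2)" "dist (G f q) (G f (e z)) < min (s / 2) (r / 2)"
      using completion_dense[OF compl G_cont[OF \<open>f \<in> S\<close>] q, of "min (s / 2) (r / 2)"] \<open>s > 0\<close> \<open>r > 0\<close> by auto
    have "\<delta> y x < s"
      using M.triangle[of "e y" p "e x"] M.commute[of "e y" p] p e x y(1) by simp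
    moreover have "r \<le> \<delta> z x"
      using M.triangle[of p "e x" q] M.triangle[of "e x" "e z" q] M.commute[of "e x" "e z"]
        M.commute[of "e z" q] p q e x z(1) by (simp add: r_def)
    moreover have "G f p = G f q"
      using eq \<open>f \<in> S\<close> by (metis \<kappa>_def restrict_apply')
    then have "cmod (f y - f z) < s"
      using dist_triangle_half_r[of "G f p" "f y" s "f z"] y(2) z(2) by (simp add: G \<open>f \<in> S\<close> dist_norm)
    ultimately show False
      using f[of y z] by simp
  qed
  have surj: "\<exists>p\<in>M. \<kappa> p = \<phi>" if \<phi>: "\<phi> \<in> characters S" for \<phi>
  proof -
    \<comment> \<open>Radius 1 suffices because \<open>S\<close> is closed under scaling: a point
      lying in \<open>Z (n f)\<close> for every natural n satisfies
      \<open>n * |G f p - \<phi> f| \<le> 1\<close> for every n, hence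
      \<open>G f p = \<phi> f\<close>.\<close>
    define Z where "Z f = {p \<in> topspace M.mtopology. G f p \<in> cball (\<phi> f) 1}" for f
    have "\<Inter> (Z ` S) \<noteq> {}"
    proof (rule compact_space_fip[THEN iffD1, OF compact, rule_format], intro conjI strip)
      fix C assume "C \<in> Z ` S"
      then obtain f where f: "f \<in> S" "C = Z f"
        by blast
      show "closedin M.mtopology C"
        unfolding f(2) Z_def by (rule closedin_continuous_map_preimage[OF G_cont[OF f(1)]]) simp
    next
      fix \<F> assume "finite \<F> \<and> \<F> \<subseteq> Z ` S"
      then obtain F where F: "finite F" "F \<subseteq> S" "\<F> = Z ` F"
        by (meson finite_subset_image)
      obtain x where "\<And>f. f \<in> F \<Longrightarrow> cmod (f x - \<phi> f) < 1"
        using S.character_approx[OF \<phi> F(1,2), of 1] by auto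
      then have "e x \<in> Z f" if "f \<in> F" for f
        using that[THEN \<open>\<And>f. f \<in> F \<Longrightarrow> cmod (f x - \<phi> f) < 1\<close>] that F(2) e(1)[of x]
        by (simp add: Z_def G subset_iff dist_norm norm_minus_commute less_imp_le)
      then show "\<Inter> \<F> \<noteq> {}"
        using F(3) by blast
    qed
    then obtain p where p: "\<And>f. f \<in> S \<Longrightarrow> p \<in> Z f"
      by blast
    then have "p \<in> M"
      using S.one by (auto simp: Z_def)
    have "G f p = \<phi> f" if "f \<in> S" for f
    proof (rule ccontr)
      assume "G f p \<noteq> \<phi> f"
      then obtain n where n: "1 < real n * cmod (G f p - \<phi> f)"
        using ex_less_of_nat_mult[of "cmod (G f p - \<phi> f)" 1] by auto
      have "\<phi> (\<lambda>x. of_nat n * f x) = of_nat n * \<phi> f"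
        using \<phi> that by (auto simp: characters_def)
      then have "cmod (of_nat n * G f p - of_nat n * \<phi> f) \<le> 1"
        using p[OF S.scale[OF that, of "of_nat n"]] \<open>p \<in> M\<close> that
        by (simp add: Z_def G_scale dist_norm norm_minus_commute)
      then show False
        using n by (simp add: norm_mult flip: right_diff_distrib)
    qed
    moreover have "\<phi> \<in> extensional S"
      using \<phi> by (auto simp: characters_def PiE_def)
    ultimately have "\<kappa> p = \<phi>"
      by (auto simp: \<kappa>_def extensional_def restrict_def)
    then show ?thesis
      using \<open>p \<in> M\<close> by blast
  qed
  \<comment> \<open>A continuous bijection from a compact space onto a Hausdorff space has a
    continuous inverse.\<close>
  have "homeomorphic_map M.mtopology (weak_star S) \<kappa>"
    using \<kappa>_char surj
    by (intro continuous_imp_homeomorphic_map \<kappa>_cont compact Hausdorff_space_weak_star) (auto simp: topspace inj)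
  then show ?thesis
    using that \<kappa>_cont \<kappa>_e by blast
qed

section \<open>Paths and finite energy functions\<close>

text \<open>Vertices of a path are distinct, so no edge repeats and a sum along the path is a sum
  over this finite set of ordered pairs. In that form it can be compared with the energy and with
  the total length, both indexed by pairs.\<close>

definition path_edges :: "'x list \<Rightarrow> ('x \<times> 'x) set" where
  "path_edges xs = (\<lambda>i. (xs ! i, xs ! Suc i)) ` {..<length xs - 1}"

lemma finite_path_edges [simp]: "finite (path_edges xs)"
  by (simp add: path_edges_def)

lemma sum_path_edges:
  assumes "distinct xs"
  shows "(\<Sum>(x,y)\<in>path_edges xs. g x y) = (\<Sum>i<length xs - 1. g (xs ! i) (xs ! Suc i))"
proof -
  have "inj_on (\<lambda>i. (xs ! i, xs ! Suc i)) {..<length xs - 1}"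
    using assms by (auto simp: inj_on_def nth_eq_iff_index_eq)
  then show ?thesis
    unfolding path_edges_def by (simp add: sum.reindex)
qed

lemma gpath_edges_pos: "gpath b xs \<Longrightarrow> (x, y) \<in> path_edges xs \<Longrightarrow> b x y > 0"
  by (auto simp: gpath_def path_edges_def)

lemma path_length_path_edges:
  "gpath b xs \<Longrightarrow> path_length b xs = (\<Sum>(x,y)\<in>path_edges xs. 1 / b x y)"
  unfolding path_length_def using sum_path_edges[of xs "\<lambda>x y. 1 / b x y"] by (simp add: gpath_def)

lemma path_length_nonneg: "gpath b xs \<Longrightarrow> 0 \<le> path_length b xs"
  by (subst path_length_path_edges) (auto intro!: sum_nonneg dest: gpath_edges_pos intro: less_imp_le)

lemma gpath_singleton [simp]: "gpath b [x]"
  by (simp add: gpath_def)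

lemma gpath_take: "gpath b xs \<Longrightarrow> gpath b (take (Suc k) xs)"
  by (simp add: gpath_def)

lemma gpath_drop: "gpath b xs \<Longrightarrow> k < length xs \<Longrightarrow> gpath b (drop k xs)"
  by (simp add: gpath_def)

lemma gpath_Cons:
  assumes "gpath b xs" "b z (hd xs) > 0" "z \<notin> set xs"
  shows "gpath b (z # xs)" "path_length b (z # xs) = 1 / b z (hd xs) + path_length b xs"
proof -
  obtain y ys where xs: "xs = y # ys"
    using assms(1) by (cases xs) (auto simp: gpath_def)
  show "gpath b (z # xs)"
    using assms unfolding gpath_def xs by (auto simp: nth_Cons split: nat.split)
  show "path_length b (z # xs) = 1 / b z (hd xs) + path_length b xs"
    unfolding path_length_def xs by (simp add: sum.lessThan_Suc_shift del: sum.lessThan_Suc)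
qed

lemma path_length_drop_le:
  assumes "gpath b xs" "k < length xs"
  shows "path_length b (drop k xs) \<le> path_length b xs"
proof -
  have "path_edges (drop k xs) \<subseteq> path_edges xs"
  proof
    fix p assume "p \<in> path_edges (drop k xs)"
    then obtain i where "i < length xs - k - 1" "p = (xs ! (k + i), xs ! Suc (k + i))"
      by (auto simp: path_edges_def)
    then show "p \<in> path_edges xs"
      unfolding path_edges_def by (intro image_eqI[of _ _ "k + i"]) auto
  qed
  then show ?thesis
    unfolding path_length_path_edges[OF assms(1)] path_length_path_edges[OF gpath_drop[OF assms]]
    using gpath_edges_pos[OF assms(1)] by (intro sum_mono2) (auto intro: less_imp_le)
qed

text \<open>The difference telescopes along the path. Inserting \<open>sqrt (1 / b) * sqrt b\<close>
  in each term makes Cauchy-Schwarz split the sum into the length of the path and the energy along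
  it.\<close>

lemma cmod_diff_path_squared_le:
  assumes xs: "gpath b xs"
  shows "(cmod (f (hd xs) - f (last xs)))\<^sup>2
    \<le> path_length b xs * (\<Sum>(x,y)\<in>path_edges xs. b x y * (cmod (f x - f y))\<^sup>2)"
proof -
  let ?n = "length xs - 1"
  have ne: "xs \<noteq> []"
    using xs by (simp add: gpath_def)
  have "f (hd xs) - f (last xs) = (\<Sum>i<?n. f (xs ! i) - f (xs ! Suc i))"
    using ne sum_lessThan_telescope'[of "\<lambda>i. f (xs ! i)" ?n] by (simp add: hd_conv_nth last_conv_nth)
  then have "cmod (f (hd xs) - f (last xs)) \<le> (\<Sum>i<?n. cmod (f (xs ! i) - f (xs ! Suc i)))"
    by (simp add: norm_sum)
  also have "\<dots> = (\<Sum>(x,y)\<in>path_edges xs. cmod (f x - f y))"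
    using xs by (subst sum_path_edges) (auto simp: gpath_def)
  also have "\<dots> = (\<Sum>(x,y)\<in>path_edges xs. sqrt (1 / b x y) * (sqrt (b x y) * cmod (f x - f y)))"
    by (intro sum.cong) (auto simp: real_sqrt_divide dest!: gpath_edges_pos[OF xs])
  finally have "(cmod (f (hd xs) - f (last xs)))\<^sup>2
      \<le> (\<Sum>(x,y)\<in>path_edges xs. sqrt (1 / b x y) * (sqrt (b x y) * cmod (f x - f y)))\<^sup>2"
    by (rule power_mono) simp
  also have "\<dots> \<le> (\<Sum>(x,y)\<in>path_edges xs. (sqrt (1 / b x y))\<^sup>2)
      * (\<Sum>(x,y)\<in>path_edges xs. (sqrt (b x y) * cmod (f x - f y))\<^sup>2)"
    using Cauchy_Schwarz_ineq_sum[of "\<lambda>(x,y). sqrt (1 / b x y)" "\<lambda>(x,y). sqrt (b x y) * cmod (f x - f y)" "path_edges xs"]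
    by (simp add: case_prod_beta)
  also have "(\<Sum>(x,y)\<in>path_edges xs. (sqrt (1 / b x y))\<^sup>2) = path_length b xs"
    unfolding path_length_path_edges[OF xs] using gpath_edges_pos[OF xs]
    by (intro sum.cong) (auto simp: less_imp_le)
  also have "(\<Sum>(x,y)\<in>path_edges xs. (sqrt (b x y) * cmod (f x - f y))\<^sup>2)
      = (\<Sum>(x,y)\<in>path_edges xs. b x y * (cmod (f x - f y))\<^sup>2)"
    using gpath_edges_pos[OF xs] by (intro sum.cong) (auto simp: power_mult_distrib less_imp_le)
  finally show ?thesis .
qed

text \<open>In \<open>ennreal\<close> an infinite sum is the supremum of its finite partial sums, so
  the edge sum of \<open>Qt\<close> dominates any finite family of pairs. The 2 cancels the 1/2 in
  front of it; the c part only adds.\<close>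

lemma finite_energy_le_Qt:
  assumes b: "\<And>x y. 0 \<le> b x y" and Q: "Qt b c f \<le> ennreal q" and "0 \<le> q" "finite F"
  shows "(\<Sum>(x,y)\<in>F. b x y * (cmod (f x - f y))\<^sup>2) \<le> 2 * q"
proof -
  let ?g = "\<lambda>(x,y). b x y * (cmod (f x - f y))\<^sup>2"
  let ?I = "\<Sum>\<^sub>\<infinity>(x,y)\<in>UNIV. ennreal (b x y * (cmod (f x - f y))\<^sup>2)"
  have nonneg: "0 \<le> ?g p" for p
    using b by (auto simp: case_prod_beta)
  have "ennreal (sum ?g F) = (\<Sum>p\<in>F. ennreal (?g p))"
    using nonneg by (simp add: sum_ennreal)
  also have "\<dots> \<le> (SUP G\<in>{G. finite G \<and> G \<subseteq> UNIV}. \<Sum>p\<in>G. ennreal (?g p))"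
    using \<open>finite F\<close> by (intro SUP_upper) auto
  also have "\<dots> = infsum (\<lambda>p. ennreal (?g p)) UNIV"
    by (rule nonneg_infsum_complete[symmetric]) simp
  also have "\<dots> = ?I"
    by (simp add: case_prod_unfold)
  also have "?I = 2 * (?I / 2)"
    by (subst ennreal_times_divide) (simp add: mult.commute[of 2] ennreal_mult_divide_eq)
  also have "\<dots> \<le> 2 * Qt b c f"
    unfolding Qt_def by (intro mult_left_mono) auto
  also have "\<dots> \<le> 2 * ennreal q"
    using Q by (intro mult_left_mono) auto
  also have "\<dots> = ennreal (2 * q)"
    using \<open>0 \<le> q\<close> by (simp add: ennreal_mult)
  finally show ?thesis
    using \<open>0 \<le> q\<close> by (simp add: ennreal_le_iff)
qed

section \<open>The metric d when the edge lengths are summable\<close>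

locale summable_graph =
  fixes b :: "'x \<Rightarrow> 'x \<Rightarrow> real" and c :: "'x \<Rightarrow> real"
  assumes graph: "weighted_graph b c" and connected: "gconnected b"
    and summable_c: "c summable_on UNIV"
    and summable_edges: "(\<lambda>(x,y). 1 / b x y) summable_on {(x,y). b x y > 0}"
begin

definition edges :: "('x \<times> 'x) set" where "edges = {(x,y). b x y > 0}"

definition total_length :: real where "total_length = (\<Sum>\<^sub>\<infinity>(x,y)\<in>edges. 1 / b x y)"

lemma b_sym: "b x y = b y x" and b_nonneg: "0 \<le> b x y" and c_nonneg: "0 \<le> c x"
  using graph by (auto simp: weighted_graph_def)

lemma sum_edges_le: "finite F \<Longrightarrow> F \<subseteq> edges \<Longrightarrow> (\<Sum>(x,y)\<in>F. 1 / b x y) \<le> total_length"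
  unfolding total_length_def
  by (rule finite_sum_le_infsum) (use summable_edges in \<open>auto simp: edges_def\<close>)

lemma total_length_nonneg: "0 \<le> total_length"
  using sum_edges_le[of "{}"] by simp

lemma path_edges_subset: "gpath b xs \<Longrightarrow> path_edges xs \<subseteq> edges"
  using gpath_edges_pos by (force simp: edges_def)

lemma path_length_le_total_length: "gpath b xs \<Longrightarrow> path_length b xs \<le> total_length"
  by (simp add: path_length_path_edges sum_edges_le path_edges_subset)

text \<open>\<open>gconnected\<close> speaks of distinct vertices only; the one-vertex path covers
  the diagonal. The set in \<open>dmet\<close> is thus never empty, as a meaningful real
  \<open>Inf\<close> requires.\<close>

lemma path_exists: "\<exists>xs. gpath b xs \<and> hd xs = x \<and> last xs = y"
proof (cases "x = y")
  case True
  then show ?thesis by (intro exI[of _ "[x]"]) simp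
qed (use connected in \<open>auto simp: gconnected_def\<close>)

lemma dmet_le: "gpath b xs \<Longrightarrow> hd xs = x \<Longrightarrow> last xs = y \<Longrightarrow> dmet b x y \<le> path_length b xs"
  unfolding dmet_def by (rule cInf_lower) (auto intro!: bdd_belowI[of _ 0] path_length_nonneg)

lemma dmet_greatest:
  "(\<And>xs. gpath b xs \<Longrightarrow> hd xs = x \<Longrightarrow> last xs = y \<Longrightarrow> r \<le> path_length b xs) \<Longrightarrow> r \<le> dmet b x y"
  unfolding dmet_def using path_exists[of x y] by (intro cInf_greatest) auto

lemma dmet_nonneg: "0 \<le> dmet b x y"
  by (rule dmet_greatest) (rule path_length_nonneg)

lemma dmet_le_total_length: "dmet b x y \<le> total_length"
  using path_exists[of x y] dmet_le path_length_le_total_length by (metis order_trans)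

lemma dmet_self [simp]: "dmet b x x = 0"
proof -
  have "dmet b x x \<le> path_length b [x]"
    by (rule dmet_le) auto
  then show ?thesis
    using dmet_nonneg[of x x] by (simp add: path_length_def)
qed

text \<open>Prepending z to a path from w yields a path unless z already occurs on it. In that case
  the tail starting at z is itself a path to x, and no longer than the original.\<close>

lemma dmet_step:
  assumes "b z w > 0"
  shows "dmet b z x \<le> 1 / b z w + dmet b w x"
proof -
  have "dmet b z x - 1 / b z w \<le> path_length b xs" if xs: "gpath b xs" "hd xs = w" "last xs = x" for xs
  proof (cases "z \<in> set xs")
    case True
    then obtain k where k: "k < length xs" "xs ! k = z"
      by (auto simp: in_set_conv_nth)
    have "dmet b z x \<le> path_length b (drop k xs)"
      using xs k by (intro dmet_le gpath_drop) (auto simp: hd_drop_conv_nth)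
    also have "\<dots> \<le> path_length b xs"
      using xs k by (intro path_length_drop_le) auto
    moreover have "0 \<le> 1 / b z w"
      using assms by simp
    ultimately show ?thesis
      by linarith
  next
    case False
    have "dmet b z x \<le> path_length b (z # xs)"
      using xs False assms by (intro dmet_le gpath_Cons) (auto simp: gpath_def)
    then show ?thesis
      using gpath_Cons(2)[of b xs z] xs False assms by simp
  qed
  then have "dmet b z x - 1 / b z w \<le> dmet b w x"
    by (rule dmet_greatest)
  then show ?thesis by simp
qed

lemma abs_dmet_diff_le:
  assumes "b z w > 0"
  shows "\<bar>dmet b z x - dmet b w x\<bar> \<le> 1 / b z w"
  using dmet_step[OF assms, of x] dmet_step[of w z x] assms by (simp add: b_sym[of w z])

lemma cmod_diff_squared_le:
  assumes "Qt b c f \<le> ennreal q" "0 \<le> q"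
  shows "(cmod (f x - f y))\<^sup>2 \<le> 2 * q * dmet b x y"
proof -
  have *: "(cmod (f x - f y))\<^sup>2 \<le> 2 * q * path_length b xs"
    if xs: "gpath b xs" "hd xs = x" "last xs = y" for xs
  proof -
    have "(cmod (f x - f y))\<^sup>2 \<le> path_length b xs * (\<Sum>(x,y)\<in>path_edges xs. b x y * (cmod (f x - f y))\<^sup>2)"
      using cmod_diff_path_squared_le[OF xs(1), of f] xs by simp
    also have "\<dots> \<le> path_length b xs * (2 * q)"
      using finite_energy_le_Qt[OF b_nonneg assms] path_length_nonneg[OF xs(1)]
      by (intro mult_left_mono) auto
    finally show ?thesis
      by (simp add: mult_ac)
  qed
  \<comment> \<open>Passing to the infimum over paths divides by \<open>2 * q\<close>. If q = 0, a
    single path already forces f x = f y.\<close>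
  show ?thesis
  proof (cases "q = 0")
    case True
    then show ?thesis
      using * path_exists[of x y] by fastforce
  next
    case False
    then have "q > 0"
      using assms by simp
    then have "(cmod (f x - f y))\<^sup>2 / (2 * q) \<le> dmet b x y"
      using * by (intro dmet_greatest) (simp add: field_simps)
    then show ?thesis
      using \<open>q > 0\<close> by (simp add: field_simps)
  qed
qed

lemma Dt_Qt_bound:
  assumes "f \<in> Dt b c"
  obtains q where "0 \<le> q" "Qt b c f \<le> ennreal q"
  using assms that[of "enn2real (Qt b c f)"] by (auto simp: Dt_def)

text \<open>The remainder of the graph after deleting a finite edge set \<open>F\<close> carrying most of the total
  length is short, and a path towards the endpoints of \<open>F\<close> uses no edge of \<open>F\<close> before reaching one.\<close>

lemma dmet_totally_bounded:
  assumes "\<epsilon> > 0"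
  shows "\<exists>V. finite V \<and> (\<forall>x. \<exists>y\<in>V. dmet b x y < \<epsilon>)"
proof -
  have "((\<lambda>(x,y). 1 / b x y) has_sum total_length) edges"
    using summable_edges unfolding total_length_def edges_def by (rule has_sum_infsum)
  then have "((\<lambda>F. \<Sum>(x,y)\<in>F. 1 / b x y) \<longlongrightarrow> total_length) (finite_subsets_at_top edges)"
    by (simp add: has_sum_def)
  then have "\<forall>\<^sub>F F in finite_subsets_at_top edges. total_length - \<epsilon> < (\<Sum>(x,y)\<in>F. 1 / b x y)"
    using assms by (intro order_tendstoD) auto
  then obtain F where F: "finite F" "F \<subseteq> edges" "total_length - \<epsilon> < (\<Sum>(x,y)\<in>F. 1 / b x y)"
    by (auto simp: eventually_finite_subsets_at_top)
  have short: "(\<Sum>(x,y)\<in>G. 1 / b x y) < \<epsilon>" if "finite G" "G \<subseteq> edges" "G \<inter> F = {}" for G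
    using sum_edges_le[of "G \<union> F"] F that by (simp add: sum.union_disjoint)
  fix a :: 'x
  \<comment> \<open>Collecting first endpoints is enough: an edge of \<open>F\<close> can be
    traversed only from a vertex of \<open>V\<close>, and the path is cut at the first such vertex.
    Including \<open>a\<close>, where the path ends, guarantees that \<open>V\<close> is met.
    \<open>take (Suc k)\<close> keeps the vertices up to index k, so the remaining edges start at
    indices below k.\<close>
  define V where "V = insert a (fst ` F)"
  have "\<exists>y\<in>V. dmet b x y < \<epsilon>" for x
  proof -
    obtain xs where xs: "gpath b xs" "hd xs = x" "last xs = a"
      using path_exists by blast
    then have ne: "xs \<noteq> []"
      by (simp add: gpath_def)
    define P where "P k \<longleftrightarrow> k < length xs \<and> xs ! k \<in> V" for k
    have "P (length xs - 1)"
      using xs ne by (simp add: P_def V_def last_conv_nth)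
    then have P: "P (LEAST k. P k)"
      by (rule LeastI)
    define k where "k = (LEAST k. P k)"
    have k: "k < length xs" "xs ! k \<in> V"
      using P by (auto simp: k_def P_def)
    have before: "xs ! i \<notin> V" if "i < k" for i
      using that not_less_Least[of i P] k(1) by (auto simp: k_def P_def)
    define ys where "ys = take (Suc k) xs"
    have ys: "gpath b ys" "hd ys = x" "last ys = xs ! k" "length ys = Suc k"
      using gpath_take[OF xs(1)] xs k by (auto simp: ys_def simp del: take_Suc, simp add: take_Suc_conv_app_nth)
    have "fst p \<notin> V" if "p \<in> path_edges ys" for p
      using that before ys(4) by (auto simp: path_edges_def ys_def)
    then have "path_edges ys \<inter> F = {}"
      by (auto simp: V_def)
    then have "path_length b ys < \<epsilon>"
      using short[of "path_edges ys"] ys(1) by (simp add: path_length_path_edges path_edges_subset)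
    then have "dmet b x (xs ! k) < \<epsilon>"
      using dmet_le[OF ys(1-3)] by simp
    then show ?thesis
      using k by blast
  qed
  moreover have "finite V"
    using F by (simp add: V_def)
  ultimately show ?thesis
    by blast
qed

text \<open>Since \<open>d\<close> is at most \<open>1 / b\<close> across an edge, \<open>b d\<^sup>2 \<le> 1 / b\<close> there: this is where the
  summability of \<open>1 / b\<close> makes distance functions have finite energy.\<close>

lemma Qt_dmet_le:
  "Qt b c (\<lambda>z. complex_of_real (t * dmet b z x))
    \<le> ennreal (t\<^sup>2 * (total_length + total_length\<^sup>2 * infsum c UNIV))"
proof -
  define f where "f z = complex_of_real (t * dmet b z x)" for z
  have "(\<Sum>\<^sub>\<infinity>p\<in>UNIV. ennreal (case p of (z,w) \<Rightarrow> b z w * (cmod (f z - f w))\<^sup>2)) \<le> ennreal (t\<^sup>2 * total_length)"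
  proof (rule infsum_le_finite_sums)
    fix F :: "('x \<times> 'x) set" assume F: "finite F"
    have term_le: "b z w * (cmod (f z - f w))\<^sup>2 \<le> t\<^sup>2 * (1 / b z w)" if "b z w > 0" for z w
    proof -
      have "cmod (f z - f w) = \<bar>t\<bar> * \<bar>dmet b z x - dmet b w x\<bar>"
        unfolding f_def by (simp only: norm_of_real abs_mult flip: of_real_diff right_diff_distrib)
      then have "cmod (f z - f w) \<le> \<bar>t\<bar> * (1 / b z w)"
        using abs_dmet_diff_le[OF that, of x] by (simp only: mult_left_mono abs_ge_zero)
      then have "(cmod (f z - f w))\<^sup>2 \<le> (\<bar>t\<bar> * (1 / b z w))\<^sup>2"
        by (intro power_mono) auto
      then have "b z w * (cmod (f z - f w))\<^sup>2 \<le> b z w * (\<bar>t\<bar> * (1 / b z w))\<^sup>2"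
        using that by (intro mult_left_mono) auto
      also have "\<dots> = t\<^sup>2 * (1 / b z w)"
        using that by (simp add: power2_eq_square field_simps)
      finally show ?thesis .
    qed
    have "(\<Sum>(z,w)\<in>F. b z w * (cmod (f z - f w))\<^sup>2) = (\<Sum>(z,w)\<in>F \<inter> edges. b z w * (cmod (f z - f w))\<^sup>2)"
      using F b_nonneg by (intro sum.mono_neutral_right) (force simp: edges_def less_le)+
    also have "\<dots> \<le> (\<Sum>(z,w)\<in>F \<inter> edges. t\<^sup>2 * (1 / b z w))"
      by (intro sum_mono) (auto simp: edges_def intro: term_le simp del: times_divide_eq_right mult_1_right)
    also have "\<dots> = t\<^sup>2 * (\<Sum>(z,w)\<in>F \<inter> edges. 1 / b z w)"
      by (simp add: sum_distrib_left case_prod_beta)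
    also have "\<dots> \<le> t\<^sup>2 * total_length"
      using F by (intro mult_left_mono sum_edges_le) auto
    finally have "(\<Sum>(z,w)\<in>F. b z w * (cmod (f z - f w))\<^sup>2) \<le> t\<^sup>2 * total_length" .
    then show "(\<Sum>p\<in>F. ennreal (case p of (z,w) \<Rightarrow> b z w * (cmod (f z - f w))\<^sup>2)) \<le> ennreal (t\<^sup>2 * total_length)"
      using b_nonneg by (subst sum_ennreal) (auto simp: case_prod_beta intro!: ennreal_leI)
  qed (simp add: nonneg_summable_on_complete)
  \<comment> \<open>Boundedness of d by \<open>total_length\<close> reduces the c part of the energy
    to the sum of c.\<close>
  moreover have "(\<Sum>\<^sub>\<infinity>z\<in>UNIV. ennreal (c z * (cmod (f z))\<^sup>2)) \<le> ennreal (t\<^sup>2 * (total_length\<^sup>2 * infsum c UNIV))"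
  proof (rule infsum_le_finite_sums)
    fix F :: "'x set" assume F: "finite F"
    have "(cmod (f z))\<^sup>2 \<le> t\<^sup>2 * total_length\<^sup>2" for z
      using dmet_nonneg[of z x] dmet_le_total_length[of z x]
      by (simp add: f_def power_mult_distrib norm_mult mult_left_mono power_mono)
    then have "(\<Sum>z\<in>F. c z * (cmod (f z))\<^sup>2) \<le> (\<Sum>z\<in>F. c z * (t\<^sup>2 * total_length\<^sup>2))"
      using c_nonneg by (intro sum_mono mult_left_mono)
    also have "\<dots> = (\<Sum>z\<in>F. c z) * (t\<^sup>2 * total_length\<^sup>2)"
      by (simp add: sum_distrib_right)
    also have "\<dots> \<le> infsum c UNIV * (t\<^sup>2 * total_length\<^sup>2)"
      using F c_nonneg summable_c by (intro mult_right_mono finite_sum_le_infsum) auto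
    finally show "(\<Sum>z\<in>F. ennreal (c z * (cmod (f z))\<^sup>2)) \<le> ennreal (t\<^sup>2 * (total_length\<^sup>2 * infsum c UNIV))"
      using c_nonneg by (subst sum_ennreal) (auto simp: mult_ac intro!: ennreal_leI)
  qed (simp add: nonneg_summable_on_complete)
  ultimately have "Qt b c f \<le> ennreal (t\<^sup>2 * total_length) / 2 + ennreal (t\<^sup>2 * (total_length\<^sup>2 * infsum c UNIV))"
    unfolding Qt_def by (intro add_mono divide_right_mono_ennreal) (simp_all add: case_prod_unfold)
  also have "\<dots> \<le> ennreal (t\<^sup>2 * total_length) + ennreal (t\<^sup>2 * (total_length\<^sup>2 * infsum c UNIV))"
    using total_length_nonneg by (intro add_mono) (simp_all add: ennreal_divide_numeral ennreal_leI)
  also have "\<dots> = ennreal (t\<^sup>2 * (total_length + total_length\<^sup>2 * infsum c UNIV))"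
    using total_length_nonneg infsum_nonneg[of UNIV c] c_nonneg
    by (simp add: distrib_left flip: ennreal_plus)
  finally show ?thesis
    by (simp add: f_def[abs_def])
qed

section \<open>Uniform equivalence of the two metrics\<close>

lemma cmod_diff_le_sqrt_dmet:
  assumes "Qt b c f \<le> 1"
  shows "cmod (f x - f y) \<le> sqrt (2 * dmet b x y)"
  using cmod_diff_squared_le[of f 1 x y] assms by (intro real_le_rsqrt) simp

text \<open>Membership in a set of reals gives nothing about its \<open>Sup\<close> unless the set
  is bounded above; the path estimate supplies the bound.\<close>

lemma cmod_diff_le_rhomet:
  assumes "Qt b c f \<le> 1"
  shows "cmod (f x - f y) \<le> rhomet b c x y"
proof -
  have "f \<in> Dt b c"
    using order_le_less_trans[OF assms ennreal_one_less_top] by (simp add: Dt_def)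
  then show ?thesis
    unfolding rhomet_def using assms
    by (intro cSup_upper) (auto intro!: bdd_aboveI[of _ "sqrt (2 * dmet b x y)"] cmod_diff_le_sqrt_dmet)
qed

lemma rhomet_le_sqrt_dmet: "rhomet b c x y \<le> sqrt (2 * dmet b x y)"
  unfolding rhomet_def
proof (rule cSup_least)
  have "(\<lambda>_. 0) \<in> Dt b c \<and> Qt b c (\<lambda>_. 0) \<le> 1"
    by (simp add: Dt_def Qt_def case_prod_unfold)
  then show "{cmod (f x - f y) |f. f \<in> Dt b c \<and> Qt b c f \<le> 1} \<noteq> {}"
    by blast
qed (use cmod_diff_le_sqrt_dmet in auto)

text \<open>\<rho> is tested with d(.,y) divided by sqrt K, whose energy is at most (K - 1)/K. It
  vanishes at y, so its difference between x and y is d(x,y)/sqrt K.\<close>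

lemma dmet_le_rhomet:
  obtains C where "C > 0" "\<And>x y. dmet b x y \<le> C * rhomet b c x y"
proof -
  \<comment> \<open>The added 1 secures K > 0 for the division and leaves the rescaled energy at
    most 1.\<close>
  define K where "K = total_length + total_length\<^sup>2 * infsum c UNIV + 1"
  have "K > 0"
    using total_length_nonneg infsum_nonneg[of UNIV c] c_nonneg by (simp add: K_def add_nonneg_pos)
  have "dmet b x y \<le> sqrt K * rhomet b c x y" for x y
  proof -
    let ?f = "\<lambda>z. complex_of_real (1 / sqrt K * dmet b z y)"
    have "Qt b c ?f \<le> ennreal ((1 / sqrt K)\<^sup>2 * (K - 1))"
      using Qt_dmet_le[of "1 / sqrt K" y] by (simp add: K_def)
    also have "\<dots> \<le> 1"
      using \<open>K > 0\<close> by (simp add: power_divide ennreal_le_1)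
    finally have "cmod (?f x - ?f y) \<le> rhomet b c x y"
      by (rule cmod_diff_le_rhomet)
    then show ?thesis
      using \<open>K > 0\<close> dmet_nonneg[of x y] by (simp add: norm_divide norm_mult field_simps)
  qed
  then show ?thesis
    using that[of "sqrt K"] \<open>K > 0\<close> by auto
qed

lemma rhomet_uniform:
  assumes "\<epsilon> > 0"
  shows "\<exists>\<eta>>0. \<forall>x y. dmet b x y < \<eta> \<longrightarrow> rhomet b c x y < \<epsilon>"
proof (intro exI conjI strip)
  fix x y assume "dmet b x y < \<epsilon>\<^sup>2 / 2"
  then have "sqrt (2 * dmet b x y) < sqrt (\<epsilon>\<^sup>2)"
    by (intro real_sqrt_less_mono) simp
  then show "rhomet b c x y < \<epsilon>"
    using rhomet_le_sqrt_dmet[of x y] assms by simp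
qed (use assms in simp)

lemma dmet_uniform:
  assumes "\<epsilon> > 0"
  shows "\<exists>\<eta>>0. \<forall>x y. rhomet b c x y < \<eta> \<longrightarrow> dmet b x y < \<epsilon>"
proof -
  obtain C where C: "C > 0" "\<And>x y. dmet b x y \<le> C * rhomet b c x y"
    using dmet_le_rhomet by blast
  show ?thesis
  proof (intro exI conjI strip)
    fix x y assume "rhomet b c x y < \<epsilon> / C"
    then show "dmet b x y < \<epsilon>"
      using C(1) order_le_less_trans[OF C(2)[of x y], of \<epsilon>] by (simp add: field_simps)
  qed (use assms C in simp)
qed

lemma rhomet_totally_bounded:
  assumes "\<epsilon> > 0"
  shows "\<exists>V. finite V \<and> (\<forall>x. \<exists>y\<in>V. rhomet b c x y < \<epsilon>)"
  using rhomet_uniform[OF assms] dmet_totally_bounded by meson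

section \<open>Finite-energy functions and the algebra generated by them\<close>

lemma Dt_subset_uniformly_continuous: "Dt b c \<subseteq> uniformly_continuous_functions (rhomet b c)"
proof
  fix f assume "f \<in> Dt b c"
  then obtain q0 where q0: "0 \<le> q0" "Qt b c f \<le> ennreal q0"
    by (rule Dt_Qt_bound)
  \<comment> \<open>Adding 1 makes the energy bound positive, since the modulus of continuity below
    divides by \<open>2 * q\<close>.\<close>
  define q where "q = q0 + 1"
  have q: "q > 0" "Qt b c f \<le> ennreal q"
    using q0 order_trans[OF q0(2) ennreal_leI[of q0 q]] by (auto simp: q_def)
  note diff = cmod_diff_squared_le[OF q(2) less_imp_le[OF q(1)]]
  fix a :: 'x
  \<comment> \<open>f is Hoelder continuous of exponent 1/2 for d, and d is bounded by
    \<open>total_length\<close>, so f stays within a fixed distance of its value at one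
    vertex.\<close>
  have "cmod (f x) \<le> cmod (f a) + sqrt (2 * q * total_length)" for x
  proof -
    have "(cmod (f x - f a))\<^sup>2 \<le> 2 * q * total_length"
      using diff[of x a] mult_left_mono[OF dmet_le_total_length[of x a], of "2 * q"] q(1) by linarith
    then have "cmod (f x - f a) \<le> sqrt (2 * q * total_length)"
      by (rule real_le_rsqrt)
    then show ?thesis
      using norm_triangle_sub[of "f x" "f a"] by simp
  qed
  then have "f \<in> linf"
    by (auto simp: linf_def bounded_iff)
  moreover have "\<exists>\<eta>>0. \<forall>x y. rhomet b c x y < \<eta> \<longrightarrow> cmod (f x - f y) < \<epsilon>" if "\<epsilon> > 0" for \<epsilon>
  proof -
    have "\<epsilon>\<^sup>2 / (2 * q) > 0"
      using that q by simp
    then obtain \<eta> where \<eta>: "\<eta> > 0" "\<And>x y. rhomet b c x y < \<eta> \<Longrightarrow> dmet b x y < \<epsilon>\<^sup>2 / (2 * q)"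
      using dmet_uniform by meson
    have "cmod (f x - f y) < \<epsilon>" if "rhomet b c x y < \<eta>" for x y
    proof -
      have "2 * q * dmet b x y < \<epsilon>\<^sup>2"
        using \<eta>(2)[OF that] q(1) by (simp add: field_simps)
      then have "(cmod (f x - f y))\<^sup>2 < \<epsilon>\<^sup>2"
        using diff[of x y] by linarith
      then show ?thesis
        using \<open>\<epsilon> > 0\<close> by (simp add: power2_less_imp_less)
    qed
    then show ?thesis
      using \<eta>(1) by blast
  qed
  ultimately show "f \<in> uniformly_continuous_functions (rhomet b c)"
    by (simp add: uniformly_continuous_functions_def)
qed

lemma Dt_subset_linf: "Dt b c \<subseteq> linf"
  using Dt_subset_uniformly_continuous by (auto simp: uniformly_continuous_functions_def)

lemma Aalg_subset_uniformly_continuous: "Aalg b c \<subseteq> uniformly_continuous_functions (rhomet b c)"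
  unfolding Aalg_def
  using sup_closure_mono[OF Dt_subset_uniformly_continuous]
    cstar_subalgebra_uniformly_continuous_functions[of "rhomet b c"]
  by (auto simp: cstar_subalgebra_def)

lemma one_uniformly_continuous: "(\<lambda>_. 1) \<in> uniformly_continuous_functions (rhomet b c)"
  by (auto simp: uniformly_continuous_functions_def linf_def intro: exI[of _ 1])

lemma Aplus_subset_uniformly_continuous: "Aplus b c \<subseteq> uniformly_continuous_functions (rhomet b c)"
  unfolding Aplus_def
  using Aalg_subset_uniformly_continuous one_uniformly_continuous
    cstar_subalgebra_uniformly_continuous_functions[of "rhomet b c"] by blast

lemma dmet_in_Aplus: "(\<lambda>z. complex_of_real (dmet b z x)) \<in> Aplus b c"
proof -
  have "(\<lambda>z. complex_of_real (dmet b z x)) \<in> Dt b c"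
    using order_le_less_trans[OF Qt_dmet_le[of 1 x] ennreal_less_top] by (simp add: Dt_def)
  then have "(\<lambda>z. complex_of_real (dmet b z x)) \<in> Aalg b c"
    unfolding Aalg_def using sup_closure_superset[of "Dt b c"] Dt_subset_linf by blast
  then show ?thesis
    by (auto simp: Aplus_def)
qed

text \<open>The function d(.,x) works: it is small where \<rho> is small, by
  \<open>d \<le> C \<rho>\<close>, and large where \<rho> is large, by
  \<open>\<rho>\<^sup>2 \<le> 2 d\<close>. Neither estimate depends on x, hence neither does
  s.\<close>

lemma Aplus_separates:
  assumes "r > 0"
  shows "\<exists>s>0. \<forall>x. \<exists>f\<in>Aplus b c. \<forall>y z.
    rhomet b c y x < s \<and> r \<le> rhomet b c z x \<longrightarrow> s \<le> cmod (f y - f z)"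
proof -
  obtain C where C: "C > 0" "\<And>x y. dmet b x y \<le> C * rhomet b c x y"
    using dmet_le_rhomet by blast
  \<comment> \<open>The solution of \<open>r\<^sup>2 / 2 - C * s = s\<close>: the lower bound for d
    at z exceeds the upper bound for d at y by exactly s.\<close>
  define s where "s = r\<^sup>2 / (2 * (C + 1))"
  have "s > 0"
    using assms C(1) by (simp add: s_def)
  moreover have "s \<le> cmod (complex_of_real (dmet b y x) - complex_of_real (dmet b z x))"
    if "rhomet b c y x < s" "r \<le> rhomet b c z x" for x y z
  proof -
    have "dmet b y x \<le> C * s"
      using C(2)[of y x] mult_left_mono[of "rhomet b c y x" s C] that(1) C(1) by linarith
    moreover have "r \<le> sqrt (2 * dmet b z x)"
      using that(2) rhomet_le_sqrt_dmet[of z x] by linarith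
    then have "r\<^sup>2 \<le> 2 * dmet b z x"
      using assms dmet_nonneg[of z x] by (simp add: real_le_rsqrt sqrt_ge_absD)
    moreover have "2 * (C + 1) * s = r\<^sup>2"
      using C(1) by (simp add: s_def)
    then have "r\<^sup>2 = 2 * (C * s) + 2 * s"
      by (simp add: algebra_simps)
    ultimately have "s \<le> \<bar>dmet b y x - dmet b z x\<bar>"
      by linarith
    then show ?thesis
      by (simp only: norm_of_real flip: of_real_diff)
  qed
  ultimately show ?thesis
    by (intro exI[of _ s] conjI allI bexI[OF _ dmet_in_Aplus]) auto
qed

end

theorem mainTheorem20:
  fixes b :: "'x \<Rightarrow> 'x \<Rightarrow> real" and c :: "'x \<Rightarrow> real"
  assumes "countable (UNIV :: 'x set)" and "infinite (UNIV :: 'x set)"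
    and "weighted_graph b c" and "gconnected b"
    and "c summable_on UNIV"
    and "(\<lambda>(x,y). 1 / b x y) summable_on {(x,y). b x y > 0}"
  shows "canonically_compactifiable b c
    \<and> (\<forall>(M :: 'm set) dM e. is_completion (dmet b) M dM e \<longrightarrow>
          compact_space (Metric_space.mtopology M dM))
    \<and> (\<forall>(M :: 'n set) dM e. is_completion (rhomet b c) M dM e \<longrightarrow>
          compact_space (Metric_space.mtopology M dM))
    \<and> (\<forall>(M1 :: 'm set) d1 e1 (M2 :: 'n set) d2 e2.
          is_completion (dmet b) M1 d1 e1 \<and> is_completion (rhomet b c) M2 d2 e2 \<longrightarrow>
          (\<exists>\<iota>. continuous_map (Metric_space.mtopology M1 d1) (Metric_space.mtopology M2 d2) \<iota>
               \<and> (\<forall>x. \<iota> (e1 x) = e2 x)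
               \<and> homeomorphic_map (Metric_space.mtopology M1 d1) (Metric_space.mtopology M2 d2) \<iota>
               \<and> (\<forall>\<iota>'. continuous_map (Metric_space.mtopology M1 d1) (Metric_space.mtopology M2 d2) \<iota>'
                        \<and> (\<forall>x. \<iota>' (e1 x) = e2 x) \<longrightarrow> (\<forall>p\<in>M1. \<iota>' p = \<iota> p))))
    \<and> (\<forall>(M :: 'n set) dM e. is_completion (rhomet b c) M dM e \<longrightarrow>
          (\<exists>\<kappa>. continuous_map (Metric_space.mtopology M dM) (weak_star (Aplus b c)) \<kappa>
               \<and> (\<forall>x. \<kappa> (e x) = point_eval (Aplus b c) x)
               \<and> homeomorphic_map (Metric_space.mtopology M dM) (weak_star (Aplus b c)) \<kappa>
               \<and> (\<forall>\<kappa>'. continuous_map (Metric_space.mtopology M dM) (weak_star (Aplus b c)) \<kappa>'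
                        \<and> (\<forall>x. \<kappa>' (e x) = point_eval (Aplus b c) x) \<longrightarrow> (\<forall>p\<in>M. \<kappa>' p = \<kappa> p))))"
proof (intro conjI allI impI)
  interpret summable_graph b c
    using assms by unfold_locales
  show "canonically_compactifiable b c"
    using Dt_subset_linf by (simp add: canonically_compactifiable_def)
  show "compact_space (Metric_space.mtopology M dM)"
    if "is_completion (dmet b) M dM e" for M :: "'m set" and dM e
    using that dmet_totally_bounded by (rule completion_compact)
  show "compact_space (Metric_space.mtopology M dM)"
    if "is_completion (rhomet b c) M dM e" for M :: "'n set" and dM e
    using that rhomet_totally_bounded by (rule completion_compact)
  fix M1 :: "'m set" and d1 e1 and M2 :: "'n set" and d2 e2
  assume "is_completion (dmet b) M1 d1 e1 \<and> is_completion (rhomet b c) M2 d2 e2"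
  then have c1: "is_completion (dmet b) M1 d1 e1" and c2: "is_completion (rhomet b c) M2 d2 e2"
    by auto
  obtain \<iota> where \<iota>: "continuous_map (Metric_space.mtopology M1 d1) (Metric_space.mtopology M2 d2) \<iota>"
    "\<forall>x. \<iota> (e1 x) = e2 x"
    "homeomorphic_map (Metric_space.mtopology M1 d1) (Metric_space.mtopology M2 d2) \<iota>"
    by (rule completions_homeomorphic[OF c1 c2 rhomet_uniform dmet_uniform]) blast+
  have "Hausdorff_space (Metric_space.mtopology M2 d2)"
    using c2 by (simp add: is_completion_def Metric_space.Hausdorff_space_mtopology)
  then have unique: "\<iota>' p = \<iota> p"
    if "continuous_map (Metric_space.mtopology M1 d1) (Metric_space.mtopology M2 d2) \<iota>'"
      "\<forall>x. \<iota>' (e1 x) = e2 x" "p \<in> M1" for \<iota>' p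
    using completion_extension_unique[OF c1 _ that(1) \<iota>(1)] that \<iota>(2) by simp
  show "\<exists>\<iota>. continuous_map (Metric_space.mtopology M1 d1) (Metric_space.mtopology M2 d2) \<iota>
      \<and> (\<forall>x. \<iota> (e1 x) = e2 x)
      \<and> homeomorphic_map (Metric_space.mtopology M1 d1) (Metric_space.mtopology M2 d2) \<iota>
      \<and> (\<forall>\<iota>'. continuous_map (Metric_space.mtopology M1 d1) (Metric_space.mtopology M2 d2) \<iota>'
               \<and> (\<forall>x. \<iota>' (e1 x) = e2 x) \<longrightarrow> (\<forall>p\<in>M1. \<iota>' p = \<iota> p))"
    by (intro exI[of _ \<iota>] conjI \<iota> allI impI ballI, elim conjE, rule unique)
next
  interpret summable_graph b c
    using assms by unfold_locales
  \<comment> \<open>The uniformly continuous functions for \<rho> are the competitor showing that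
    \<open>Aplus\<close> is an intersection over a nonempty family.\<close>
  have cstar: "cstar_subalgebra (Aplus b c)"
    using Aalg_subset_uniformly_continuous cstar_subalgebra_uniformly_continuous_functions
      one_uniformly_continuous by (rule cstar_subalgebra_Aplus)
  have one: "(\<lambda>_. 1) \<in> Aplus b c"
    by (simp add: Aplus_def)
  fix M :: "'n set" and dM e
  assume compl: "is_completion (rhomet b c) M dM e"
  have compact: "compact_space (Metric_space.mtopology M dM)"
    using compl rhomet_totally_bounded by (rule completion_compact)
  obtain \<kappa> where \<kappa>: "continuous_map (Metric_space.mtopology M dM) (weak_star (Aplus b c)) \<kappa>"
    "\<forall>x. \<kappa> (e x) = point_eval (Aplus b c) x"
    "homeomorphic_map (Metric_space.mtopology M dM) (weak_star (Aplus b c)) \<kappa>"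
    by (rule completion_homeomorphic_characters[OF compl compact cstar one
          Aplus_subset_uniformly_continuous Aplus_separates]) blast+
  have unique: "\<kappa>' p = \<kappa> p"
    if "continuous_map (Metric_space.mtopology M dM) (weak_star (Aplus b c)) \<kappa>'"
      "\<forall>x. \<kappa>' (e x) = point_eval (Aplus b c) x" "p \<in> M" for \<kappa>' p
    using completion_extension_unique[OF compl Hausdorff_space_weak_star that(1) \<kappa>(1)] that \<kappa>(2) by simp
  show "\<exists>\<kappa>. continuous_map (Metric_space.mtopology M dM) (weak_star (Aplus b c)) \<kappa>
      \<and> (\<forall>x. \<kappa> (e x) = point_eval (Aplus b c) x)
      \<and> homeomorphic_map (Metric_space.mtopology M dM) (weak_star (Aplus b c)) \<kappa>
      \<and> (\<forall>\<kappa>'. continuous_map (Metric_space.mtopology M dM) (weak_star (Aplus b c)) \<kappa>'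
               \<and> (\<forall>x. \<kappa>' (e x) = point_eval (Aplus b c) x) \<longrightarrow> (\<forall>p\<in>M. \<kappa>' p = \<kappa> p))"
    by (intro exI[of _ \<kappa>] conjI \<kappa> allI impI ballI, elim conjE, rule unique)
qed

end
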